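(* (i) If $\underline{u}$ and $\underline{v}$ are two reduced words over $\{\pi_0,\pi_1,\dots,\pi_{n-1}\}$ representing the same element of $R_n^0$, then $\underline{u}$ can be transformed into $\underline{v}$ using only the relations $\pi_i\pi_{i+1}\pi_i=\pi_{i+1}\pi_i\pi_{i+1}$ ($1\le i\le n-2$) and $\pi_i\pi_j=\pi_j\pi_i$ ($0\le i,j\le n-1$, $|i-j|\ge 2$). (ii) If $\underline{u}$ and $\underline{v}$ are two reduced words over $\{\pi_0,s_1,\dots,s_{n-1}\}$ representing the same element of the rook monoid $R_n$, then $\underline{u}$ can be transformed into $\underline{v}$ using only the relations $s_is_{i+1}s_i=s_{i+1}s_is_{i+1}$ ($1\le i\le n-2$), $s_is_j=s_js_i$ ($|i-j|\ge2$) and $\pi_0s_j=s_j\pi_0$ ($j\ne1$).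
   Context: $R_n$ is the rook monoid: the monoid (under matrix product) of $n\times n$ matrices with entries in $\{0,1\}$ having at most one nonzero entry in each row and column; $s_i$ ($1\le i\le n-1$) is the permutation matrix of the transposition $(i,i+1)$ and $\pi_0$ is the diagonal matrix $\mathrm{diag}(0,1,\dots,1)$; these generate $R_n$. $R_n^0$ is the monoid presented by generators $\pi_0,\dots,\pi_{n-1}$ and relations $\pi_i^2=\pi_i$ ($0\le i\le n-1$), $\pi_i\pi_{i+1}\pi_i=\pi_{i+1}\pi_i\pi_{i+1}$ ($1\le i\le n-2$), $\pi_1\pi_0\pi_1\pi_0=\pi_0\pi_1\pi_0=\pi_0\pi_1\pi_0\pi_1$, $\pi_i\pi_j=\pi_j\pi_i$ ($|i-j|\ge2$). A word in the generators representing an element is reduced if it has minimal length among all words representing that element. *)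

theory Defs
  imports
    "HOL-Combinatorics.Transposition"
    "HOL-Algebra.Group"
    "Jordan_Normal_Form.Matrix"
begin

section \<open>Words and presented monoids\<close>

definition rewrite_step :: "('a list \<times> 'a list) set \<Rightarrow> 'a list \<Rightarrow> 'a list \<Rightarrow> bool" where
  "rewrite_step R u v \<longleftrightarrow> (\<exists>x y l r. (l, r) \<in> R \<and> u = x @ l @ y \<and> v = x @ r @ y)"

text \<open>A relation may be applied in either direction, any number of times and at any place of
  a word.\<close>

definition transformable :: "('a list \<times> 'a list) set \<Rightarrow> 'a list \<Rightarrow> 'a list \<Rightarrow> bool" where
  "transformable R = equivclp (rewrite_step R)"

definition word_congruence :: "('a list \<times> 'a list) set \<Rightarrow> ('a list \<times> 'a list) set" where
  "word_congruence R = {(u, v). transformable R u v}"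

definition presented_monoid :: "'a set \<Rightarrow> ('a list \<times> 'a list) set \<Rightarrow> 'a list set monoid" where
  "presented_monoid A R =
    \<lparr>carrier = lists A // word_congruence R,
     mult = (\<lambda>X Y. \<Union>u\<in>X. \<Union>v\<in>Y. word_congruence R `` {u @ v}),
     one = word_congruence R `` {[]}\<rparr>"

definition word_value :: "('b, 'm) monoid_scheme \<Rightarrow> ('a \<Rightarrow> 'b) \<Rightarrow> 'a list \<Rightarrow> 'b" where
  "word_value G g w = foldr (\<lambda>a x. g a \<otimes>\<^bsub>G\<^esub> x) w \<one>\<^bsub>G\<^esub>"

definition reduced_word ::
  "('b, 'm) monoid_scheme \<Rightarrow> 'a set \<Rightarrow> ('a \<Rightarrow> 'b) \<Rightarrow> 'a list \<Rightarrow> bool" where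
  "reduced_word G A g w \<longleftrightarrow>
    w \<in> lists A \<and>
    (\<forall>w'\<in>lists A. word_value G g w' = word_value G g w \<longrightarrow> length w \<le> length w')"

section \<open>The monoid \<open>R\<^sub>n\<^sup>0\<close>\<close>

text \<open>Here the letter \<open>i < n\<close> stands for the generator \<open>\<pi>\<^sub>i\<close>.\<close>

definition R0_braid_rels :: "nat \<Rightarrow> (nat list \<times> nat list) set" where
  "R0_braid_rels n =
    {([i, i + 1, i], [i + 1, i, i + 1]) | i. 1 \<le> i \<and> i + 1 < n}"

definition R0_commutation_rels :: "nat \<Rightarrow> (nat list \<times> nat list) set" where
  "R0_commutation_rels n =
    {([i, j], [j, i]) | i j. i < n \<and> j < n \<and> \<bar>int i - int j\<bar> \<ge> 2}"

definition R0_rels :: "nat \<Rightarrow> (nat list \<times> nat list) set" where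
  "R0_rels n =
    {([i, i], [i]) | i. i < n} \<union>
    R0_braid_rels n \<union>
    (if 1 < n then {([1, 0, 1, 0], [0, 1, 0]), ([0, 1, 0], [0, 1, 0, 1])} else {}) \<union>
    R0_commutation_rels n"

definition R0_monoid :: "nat \<Rightarrow> nat list set monoid" where
  "R0_monoid n = presented_monoid {..<n} (R0_rels n)"

definition R0_gen :: "nat \<Rightarrow> nat \<Rightarrow> nat list set" where
  "R0_gen n i = word_congruence (R0_rels n) `` {[i]}"

section \<open>The rook monoid \<open>R\<^sub>n\<close>\<close>

definition rook_matrices :: "nat \<Rightarrow> int mat set" where
  "rook_matrices n =
    {M \<in> carrier_mat n n.
      (\<forall>i<n. \<forall>j<n. M $$ (i, j) \<in> {0, 1}) \<and>
      (\<forall>i<n. card {j. j < n \<and> M $$ (i, j) \<noteq> 0} \<le> 1) \<and>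
      (\<forall>j<n. card {i. i < n \<and> M $$ (i, j) \<noteq> 0} \<le> 1)}"

definition rook_monoid :: "nat \<Rightarrow> int mat monoid" where
  "rook_monoid n = \<lparr>carrier = rook_matrices n, mult = (*), one = 1\<^sub>m n\<rparr>"

text \<open>Matrix rows and columns are indexed from \<open>0\<close>, so the transposition
  \<open>(i, i + 1)\<close> of \<open>{1..n}\<close> exchanges the indices \<open>i - 1\<close> and \<open>i\<close>, and the first diagonal
  entry has index \<open>(0, 0)\<close>.\<close>

definition rook_s :: "nat \<Rightarrow> nat \<Rightarrow> int mat" where
  "rook_s n i =
    mat n n (\<lambda>(r, c). if r = Transposition.transpose (i - 1) i c then 1 else 0)"

definition rook_pi0 :: "nat \<Rightarrow> int mat" where
  "rook_pi0 n = mat_diag n (\<lambda>k. if k = 0 then 0 else 1)"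

text \<open>Here the letter \<open>0\<close> stands for \<open>\<pi>\<^sub>0\<close> and the letter \<open>i\<close> with \<open>1 \<le> i < n\<close> for \<open>s\<^sub>i\<close>.\<close>

definition rook_gen :: "nat \<Rightarrow> nat \<Rightarrow> int mat" where
  "rook_gen n i = (if i = 0 then rook_pi0 n else rook_s n i)"

definition rook_braid_rels :: "nat \<Rightarrow> (nat list \<times> nat list) set" where
  "rook_braid_rels n =
    {([i, i + 1, i], [i + 1, i, i + 1]) | i. 1 \<le> i \<and> i + 1 < n}"

definition rook_commutation_rels :: "nat \<Rightarrow> (nat list \<times> nat list) set" where
  "rook_commutation_rels n =
    {([i, j], [j, i]) | i j. 1 \<le> i \<and> i < n \<and> 1 \<le> j \<and> j < n \<and> \<bar>int i - int j\<bar> \<ge> 2} \<union>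
    {([0, j], [j, 0]) | j. 1 \<le> j \<and> j < n \<and> j \<noteq> 1}"

section \<open>Well-definedness\<close>

lemma transformable_append:
  assumes "transformable R u u'" "transformable R v v'"
  shows "transformable R (u @ v) (u' @ v')"
proof -
  have rs: "rewrite_step R (a @ x @ b) (a @ y @ b)" if s: "rewrite_step R x y" for x y a b
  proof -
    obtain p q l r where h: "(l, r) \<in> R" "x = p @ l @ q" "y = p @ r @ q"
      using s unfolding rewrite_step_def by blast
    have "a @ x @ b = (a @ p) @ l @ (q @ b)" "a @ y @ b = (a @ p) @ r @ (q @ b)"
      using h by simp_all
    then show ?thesis using h(1) unfolding rewrite_step_def by blast
  qed
  have ctx: "equivclp (rewrite_step R) (a @ x @ b) (a @ y @ b)"
    if "equivclp (rewrite_step R) x y" for x y a b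
    using that
  proof (induction rule: equivclp_induct)
    case base
    show ?case by simp
  next
    case (step y z)
    from step(2) have "rewrite_step R (a @ y @ b) (a @ z @ b) \<or> rewrite_step R (a @ z @ b) (a @ y @ b)"
      using rs by blast
    then have "equivclp (rewrite_step R) (a @ y @ b) (a @ z @ b)"
      by (blast intro: r_into_equivclp converse_r_into_equivclp)
    with step(3) show ?case by (rule equivclp_trans)
  qed
  have "equivclp (rewrite_step R) (u @ v) (u' @ v)"
    using ctx[of u u' "[]" v] assms(1) by (simp add: transformable_def)
  moreover have "equivclp (rewrite_step R) (u' @ v) (u' @ v')"
    using ctx[of v v' u' "[]"] assms(2) by (simp add: transformable_def)
  ultimately show ?thesis unfolding transformable_def by (rule equivclp_trans)
qed

lemma equiv_word_congruence: "equiv UNIV (word_congruence R)"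
  using equivp_evquivclp[of "rewrite_step R"]
  by (simp add: word_congruence_def transformable_def equivp_equiv)

lemma presented_monoid_mult:
  "word_congruence R `` {u} \<otimes>\<^bsub>presented_monoid A R\<^esub> word_congruence R `` {v} =
   word_congruence R `` {u @ v}"
proof -
  let ?U = "word_congruence R `` {u}" and ?V = "word_congruence R `` {v}"
  have eq: "word_congruence R `` {a @ b} = word_congruence R `` {u @ v}"
    if "a \<in> ?U" "b \<in> ?V" for a b
  proof -
    have "transformable R u a" "transformable R v b"
      using that by (simp_all add: word_congruence_def)
    then have "(u @ v, a @ b) \<in> word_congruence R"
      by (simp add: word_congruence_def transformable_append)
    then show ?thesis
      by (rule equiv_class_eq[OF equiv_word_congruence, symmetric])
  qed
  have "u \<in> ?U" "v \<in> ?V"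
    using equiv_class_self[OF equiv_word_congruence] by blast+
  then have "(\<Union>a\<in>?U. \<Union>b\<in>?V. word_congruence R `` {u @ v}) = word_congruence R `` {u @ v}"
    by blast
  moreover have "(\<Union>a\<in>?U. \<Union>b\<in>?V. word_congruence R `` {a @ b}) =
      (\<Union>a\<in>?U. \<Union>b\<in>?V. word_congruence R `` {u @ v})"
    by (intro SUP_cong refl eq)
  ultimately show ?thesis
    by (simp add: presented_monoid_def)
qed

lemma monoid_presented_monoid: "monoid (presented_monoid A R)"
proof (rule monoidI)
  let ?M = "presented_monoid A R" and ?c = "\<lambda>w. word_congruence R `` {w}"
  have carr: "X \<in> carrier ?M \<longleftrightarrow> (\<exists>w\<in>lists A. X = ?c w)" for X
    by (auto simp: presented_monoid_def quotient_def)
  have one: "\<one>\<^bsub>?M\<^esub> = ?c []" by (simp add: presented_monoid_def)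
  show "\<one>\<^bsub>?M\<^esub> \<in> carrier ?M" unfolding carr one by auto
  show "X \<otimes>\<^bsub>?M\<^esub> Y \<in> carrier ?M" if XY: "X \<in> carrier ?M" "Y \<in> carrier ?M" for X Y
  proof -
    obtain u v where h: "u \<in> lists A" "v \<in> lists A" "X = ?c u" "Y = ?c v"
      using XY carr by metis
    then have "u @ v \<in> lists A" by simp
    then show ?thesis unfolding carr h presented_monoid_mult by blast
  qed
  show "X \<otimes>\<^bsub>?M\<^esub> Y \<otimes>\<^bsub>?M\<^esub> Z = X \<otimes>\<^bsub>?M\<^esub> (Y \<otimes>\<^bsub>?M\<^esub> Z)"
    if "X \<in> carrier ?M" "Y \<in> carrier ?M" "Z \<in> carrier ?M" for X Y Z
    using that carr by (auto simp: presented_monoid_mult)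
  show "\<one>\<^bsub>?M\<^esub> \<otimes>\<^bsub>?M\<^esub> X = X" "X \<otimes>\<^bsub>?M\<^esub> \<one>\<^bsub>?M\<^esub> = X" if "X \<in> carrier ?M" for X
    using that carr by (auto simp: presented_monoid_mult one)
qed

lemma word_value_R0:
  "word_value (R0_monoid n) (R0_gen n) w = word_congruence (R0_rels n) `` {w}"
proof (induction w)
  case Nil
  show ?case by (simp add: word_value_def R0_monoid_def presented_monoid_def)
next
  case (Cons a w)
  then show ?case
    using presented_monoid_mult[where R = "R0_rels n" and u = "[a]" and v = w and A = "{..<n}"]
    by (simp add: word_value_def R0_monoid_def R0_gen_def)
qed

lemma card_le_1_iff:
  "card {j. j < (n :: nat) \<and> P j} \<le> 1 \<longleftrightarrow> (\<forall>j<n. \<forall>k<n. P j \<longrightarrow> P k \<longrightarrow> j = k)"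
  by (auto simp: card_le_Suc0_iff_eq)

lemma rook_matrices_iff:
  "M \<in> rook_matrices n \<longleftrightarrow>
    M \<in> carrier_mat n n \<and>
    (\<forall>i<n. \<forall>j<n. M $$ (i, j) \<in> {0, 1}) \<and>
    (\<forall>i<n. \<forall>j<n. \<forall>k<n. M $$ (i, j) \<noteq> 0 \<longrightarrow> M $$ (i, k) \<noteq> 0 \<longrightarrow> j = k) \<and>
    (\<forall>j<n. \<forall>i<n. \<forall>k<n. M $$ (i, j) \<noteq> 0 \<longrightarrow> M $$ (k, j) \<noteq> 0 \<longrightarrow> i = k)"
  unfolding rook_matrices_def mem_Collect_eq card_le_1_iff ..

lemma rook_matrices_mult:
  assumes "M \<in> rook_matrices n" "N \<in> rook_matrices n"
  shows "M * N \<in> rook_matrices n"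
proof -
  have M: "M \<in> carrier_mat n n" and N: "N \<in> carrier_mat n n"
    using assms by (auto simp: rook_matrices_def)
  have row: "j = k"
    if "A \<in> {M, N}" "i < n" "j < n" "k < n" "A $$ (i, j) \<noteq> 0" "A $$ (i, k) \<noteq> 0" for A i j k
    using assms that unfolding rook_matrices_iff by (metis insertE singletonD)
  have col: "i = k"
    if "A \<in> {M, N}" "i < n" "j < n" "k < n" "A $$ (i, j) \<noteq> 0" "A $$ (k, j) \<noteq> 0" for A i j k
    using assms that unfolding rook_matrices_iff by (metis insertE singletonD)
  have val: "A $$ (i, j) = 1" if "A \<in> {M, N}" "i < n" "j < n" "A $$ (i, j) \<noteq> 0" for A i j
    using assms that unfolding rook_matrices_iff by (metis insertE singletonD)
  have entry: "(M * N) $$ (i, j) = (\<Sum>k<n. M $$ (i, k) * N $$ (k, j))" if "i < n" "j < n" for i j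
    using M N that by (simp add: scalar_prod_def atLeast0LessThan)
  have nz: "\<exists>k<n. M $$ (i, k) \<noteq> 0 \<and> N $$ (k, j) \<noteq> 0"
    if "i < n" "j < n" "(M * N) $$ (i, j) \<noteq> 0" for i j
    using sum.not_neutral_contains_not_neutral[of "\<lambda>k. M $$ (i, k) * N $$ (k, j)" "{..<n}"]
      entry[OF that(1,2)] that(3) by auto
  have E: "(M * N) $$ (i, j) \<in> {0, 1}" if ij: "i < n" "j < n" for i j
  proof (cases "(M * N) $$ (i, j) = 0")
    case False
    then obtain k where k: "k < n" "M $$ (i, k) \<noteq> 0" "N $$ (k, j) \<noteq> 0"
      using nz ij by blast
    have "M $$ (i, k') = 0" if "k' < n" "k' \<noteq> k" for k'
      using row[of M i k' k] ij(1) k(1,2) that by auto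
    then have "(\<Sum>k<n. M $$ (i, k) * N $$ (k, j)) = (\<Sum>k'\<in>{k}. M $$ (i, k') * N $$ (k', j))"
      using k(1) by (intro sum.mono_neutral_right) auto
    moreover have "M $$ (i, k) = 1" "N $$ (k, j) = 1"
      using val[of M i k] val[of N k j] ij k by auto
    ultimately show ?thesis using entry[OF ij] by simp
  qed simp
  have Rw: "j = j'"
    if h: "i < n" "j < n" "j' < n" "(M * N) $$ (i, j) \<noteq> 0" "(M * N) $$ (i, j') \<noteq> 0" for i j j'
  proof -
    obtain k k' where
      "k < n" "M $$ (i, k) \<noteq> 0" "N $$ (k, j) \<noteq> 0"
      "k' < n" "M $$ (i, k') \<noteq> 0" "N $$ (k', j') \<noteq> 0"
      using nz[OF h(1,2,4)] nz[OF h(1,3,5)] by blast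
    then show ?thesis using row[of M i k k'] row[of N k j j'] h by auto
  qed
  have Cl: "i = i'"
    if h: "i < n" "i' < n" "j < n" "(M * N) $$ (i, j) \<noteq> 0" "(M * N) $$ (i', j) \<noteq> 0" for i i' j
  proof -
    obtain k k' where
      "k < n" "M $$ (i, k) \<noteq> 0" "N $$ (k, j) \<noteq> 0"
      "k' < n" "M $$ (i', k') \<noteq> 0" "N $$ (k', j) \<noteq> 0"
      using nz[OF h(1,3,4)] nz[OF h(2,3,5)] by blast
    then show ?thesis using col[of N k j k'] col[of M i k i'] h by auto
  qed
  show ?thesis
    unfolding rook_matrices_iff
  proof (intro conjI allI impI)
    show "M * N \<in> carrier_mat n n" using M N by (rule mult_carrier_mat)
  next
    fix i j assume "i < n" "j < n"
    then show "(M * N) $$ (i, j) \<in> {0, 1}" by (rule E)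
  next
    fix i j k assume "i < n" "j < n" "k < n" "(M * N) $$ (i, j) \<noteq> 0" "(M * N) $$ (i, k) \<noteq> 0"
    then show "j = k" by (rule Rw)
  next
    fix j i k assume "j < n" "i < n" "k < n" "(M * N) $$ (i, j) \<noteq> 0" "(M * N) $$ (k, j) \<noteq> 0"
    then show "i = k" using Cl[of i k j] by simp
  qed
qed

lemma monoid_rook_monoid: "monoid (rook_monoid n)"
proof (rule monoidI)
  show "\<one>\<^bsub>rook_monoid n\<^esub> \<in> carrier (rook_monoid n)"
    unfolding rook_monoid_def rook_matrices_def card_le_1_iff by (auto split: if_splits)
  show "x \<otimes>\<^bsub>rook_monoid n\<^esub> y \<otimes>\<^bsub>rook_monoid n\<^esub> z = x \<otimes>\<^bsub>rook_monoid n\<^esub> (y \<otimes>\<^bsub>rook_monoid n\<^esub> z)"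
    if "x \<in> carrier (rook_monoid n)" "y \<in> carrier (rook_monoid n)" "z \<in> carrier (rook_monoid n)"
    for x y z
    using that by (auto simp: rook_monoid_def rook_matrices_def intro: assoc_mult_mat)
  show "x \<otimes>\<^bsub>rook_monoid n\<^esub> y \<in> carrier (rook_monoid n)"
    if "x \<in> carrier (rook_monoid n)" "y \<in> carrier (rook_monoid n)" for x y
    using that by (simp add: rook_monoid_def rook_matrices_mult)
  show "\<one>\<^bsub>rook_monoid n\<^esub> \<otimes>\<^bsub>rook_monoid n\<^esub> x = x"
    "x \<otimes>\<^bsub>rook_monoid n\<^esub> \<one>\<^bsub>rook_monoid n\<^esub> = x"
    if "x \<in> carrier (rook_monoid n)" for x
    using that by (auto simp: rook_monoid_def rook_matrices_def)
qed

lemma rook_gen_carrier: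
  assumes "i < n"
  shows "rook_gen n i \<in> carrier (rook_monoid n)"
proof (cases "i = 0")
  case True
  then show ?thesis
    by (auto simp: rook_gen_def rook_pi0_def mat_diag_def rook_monoid_def rook_matrices_iff)
next
  case False
  let ?t = "Transposition.transpose (i - 1) i"
  have nz: "rook_s n i $$ (r, c) \<noteq> 0 \<longleftrightarrow> r = ?t c" and
    val: "rook_s n i $$ (r, c) \<in> {0, 1}" if "r < n" "c < n" for r c
    using that by (simp_all add: rook_s_def)
  have inj: "c = c'" if "?t c = ?t c'" for c c'
    using injD[OF inj_transpose that] .
  have "rook_s n i \<in> rook_matrices n"
    unfolding rook_matrices_iff
  proof (intro conjI allI impI)
    show "rook_s n i \<in> carrier_mat n n" by (simp add: rook_s_def)
  next
    fix r c c' assume "r < n" "c < n" "c' < n" "rook_s n i $$ (r, c) \<noteq> 0" "rook_s n i $$ (r, c') \<noteq> 0"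
    then have "?t c = ?t c'" using nz[of r c] nz[of r c'] by metis
    then show "c = c'" by (rule inj)
  next
    fix c r r' assume "c < n" "r < n" "r' < n" "rook_s n i $$ (r, c) \<noteq> 0" "rook_s n i $$ (r', c) \<noteq> 0"
    then show "r = r'" using nz[of r c] nz[of r' c] by metis
  next
    fix r c assume "r < n" "c < n"
    then show "rook_s n i $$ (r, c) \<in> {0, 1}" by (rule val)
  qed
  with False show ?thesis by (simp add: rook_gen_def rook_monoid_def)
qed

end

theory Submission
  imports Defs
begin

text \<open>An element of the rook monoid is the vector listing, column by column, the row of the nonzero
  entry (counted from 1, and 0 for a zero column); right multiplication by \<open>s\<^sub>i\<close> swaps the entries
  \<open>i\<close> and \<open>i + 1\<close> and \<open>\<pi>\<^sub>0\<close> erases the first one. \<open>R\<^sub>n\<^sup>0\<close> acts on the same vectors, except that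
  \<open>\<pi>\<^sub>i\<close> only swaps entries in increasing order. The number of inversions plus the sum of the
  missing letters grows by at most one in every step, so the reduced words are those that
  make it grow by exactly one in each step. Such a word can be read backwards:
  the last letter determines the previous vector, and any two possible last letters are resolved
  by a braid or commutation relation, because a vector never descends at \<open>0\<close> and at \<open>1\<close>
  simultaneously. This gives Matsumoto's argument for both monoids. For \<open>R\<^sub>n\<^sup>0\<close>, given only by a
  presentation, one also shows that every word is equivalent to such an ascending word.\<close>

section \<open>Rook vectors and their length\<close>

definition rook_vector :: "nat \<Rightarrow> nat list \<Rightarrow> bool" where
  "rook_vector n x \<longleftrightarrow> length x = n \<and> set x \<subseteq> {..n} \<and> distinct (filter (\<lambda>k. k \<noteq> 0) x)"

definition missing :: "nat \<Rightarrow> nat list \<Rightarrow> nat set" where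
  "missing n x = {1..n} - set x"

fun rook_act :: "nat list \<Rightarrow> nat \<Rightarrow> nat list" where
  "rook_act x 0 = x[0 := 0]"
| "rook_act x (Suc i) = x[i := x ! Suc i, Suc i := x ! i]"

text \<open>At \<open>0\<close> the condition is exactly what makes erasing the first entry raise
  \<open>rook_length\<close> by one. The letter \<open>Suc i\<close> exchanges the 0-based positions
  \<open>i\<close> and \<open>Suc i\<close>.\<close>

fun ascent :: "nat \<Rightarrow> nat list \<Rightarrow> nat \<Rightarrow> bool" where
  "ascent n x 0 \<longleftrightarrow> x ! 0 \<noteq> 0 \<and> (\<forall>m\<in>missing n x. m < x ! 0)"
| "ascent n x (Suc i) \<longleftrightarrow> x ! i < x ! Suc i"

fun descent :: "nat list \<Rightarrow> nat \<Rightarrow> bool" where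
  "descent x 0 \<longleftrightarrow> x ! 0 = 0"
| "descent x (Suc i) \<longleftrightarrow> x ! Suc i < x ! i"

text \<open>When \<open>x\<close> descends at \<open>a\<close>, this is the only vector from which
  an ascent at \<open>a\<close> leads to \<open>x\<close>. At \<open>0\<close> the largest missing
  letter has to be restored, since an erasure is an ascent only if the erased letter exceeds all
  missing ones.\<close>

fun lower :: "nat \<Rightarrow> nat list \<Rightarrow> nat \<Rightarrow> nat list" where
  "lower n x 0 = x[0 := Max (missing n x)]"
| "lower n x (Suc i) = rook_act x (Suc i)"

fun inversions :: "nat list \<Rightarrow> nat" where
  "inversions [] = 0"
| "inversions (a # xs) = length (filter (\<lambda>b. b < a) xs) + inversions xs"

text \<open>\<open>inversions\<close> compares strictly, so two zeros form no inversion, while a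
  zero forms one with every nonzero entry to its left.\<close>

definition rook_length :: "nat \<Rightarrow> nat list \<Rightarrow> nat" where
  "rook_length n x = inversions x + \<Sum>(missing n x)"

lemma finite_missing [simp]: "finite (missing n x)"
  by (simp add: missing_def)

lemma length_rook_act [simp]: "length (rook_act x a) = length x"
  by (cases a) simp_all

lemma length_lower [simp]: "length (lower n x a) = length x"
  by (cases a) simp_all

lemma mset_rook_act_Suc: "Suc i < length x \<Longrightarrow> mset (rook_act x (Suc i)) = mset x"
  by (simp add: mset_swap)

lemma set_rook_act_Suc: "Suc i < length x \<Longrightarrow> set (rook_act x (Suc i)) = set x"
  using mset_rook_act_Suc mset_eq_setD by blast

lemma missing_rook_act_Suc [simp]:
  "Suc i < length x \<Longrightarrow> missing n (x[i := x ! Suc i, Suc i := x ! i]) = missing n x"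
  using set_rook_act_Suc[of i x] by (simp add: missing_def)

lemma rook_vector_mset:
  assumes "mset x = mset y"
  shows "rook_vector n x \<longleftrightarrow> rook_vector n y"
  using assms mset_eq_setD[OF assms] mset_eq_length[OF assms]
    mset_eq_imp_distinct_iff[of "filter (\<lambda>k. k \<noteq> 0) x" "filter (\<lambda>k. k \<noteq> 0) y"]
  by (simp add: rook_vector_def)

lemma rook_vector_rook_act:
  assumes "rook_vector n x" "a < n"
  shows "rook_vector n (rook_act x a)"
proof (cases a)
  case 0
  then show ?thesis using assms by (cases x) (auto simp: rook_vector_def split: if_splits)
next
  case (Suc i)
  then have "Suc i < length x" using assms by (simp add: rook_vector_def)
  then show ?thesis
    using rook_vector_mset[OF mset_rook_act_Suc] assms(1) Suc by simp
qed

section \<open>Missing letters and the growth of the length\<close>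

lemma missing_bound: "m \<in> missing n x \<Longrightarrow> 0 < m \<and> m \<le> n \<and> m \<notin> set x"
  by (auto simp: missing_def)

text \<open>By pigeonhole: \<open>n\<close> positions cannot hold all the values from 0 to
  \<open>n\<close>. This gives \<open>Max (missing n x)\<close> a meaning in
  \<open>lower\<close>.\<close>

lemma missing_nonempty:
  assumes "rook_vector n x" "0 \<in> set x"
  shows "missing n x \<noteq> {}"
proof
  assume "missing n x = {}"
  then have "{0..n} \<subseteq> set x" using assms(2)
    by (auto simp: missing_def) (metis atLeastAtMost_iff not_less_eq_eq le_zero_eq subsetD)
  then have "Suc n \<le> card (set x)" using card_mono[of "set x" "{0..n}"] by simp
  then show False using card_length[of x] assms(1) by (simp add: rook_vector_def)
qed

text \<open>Each of the \<open>n - c\<close> values above \<open>c\<close> is either missing or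
  occurs exactly once in \<open>xs\<close>, and the \<open>n - 1\<close> entries of
  \<open>xs\<close> all differ from \<open>c\<close>; subtracting leaves the entries below
  \<open>c\<close>, zeros included. These are the inversions lost when \<open>c\<close> is
  erased.\<close>

lemma card_missing_above:
  assumes "rook_vector n (c # xs)" "c \<noteq> 0"
  shows "length (filter (\<lambda>b. b < c) xs) + 1 = c + card {m \<in> missing n (c # xs). c < m}"
proof -
  have V: "Suc (length xs) = n" "c \<le> n" "set xs \<subseteq> {..n}" "c \<notin> set xs"
    "distinct (filter (\<lambda>k. k \<noteq> 0) xs)"
    using assms by (auto simp: rook_vector_def)
  have "filter (\<lambda>b. c < b) xs = filter (\<lambda>b. c < b) (filter (\<lambda>k. k \<noteq> 0) xs)"
    by (auto intro: filter_cong)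
  then have "distinct (filter (\<lambda>b. c < b) xs)"
    using V(5) by (metis distinct_filter)
  then have 1: "length (filter (\<lambda>b. c < b) xs) = card (set xs \<inter> {c<..n})"
    using V(3) by (subst distinct_card[symmetric]) (auto intro!: arg_cong[where f = card])
  have 2: "length (filter (\<lambda>b. b < c) xs) + length (filter (\<lambda>b. c < b) xs) = length xs"
  proof -
    have "filter (\<lambda>b. c < b) xs = filter (\<lambda>b. \<not> b < c) xs"
      using V(4) by (intro filter_cong) (auto simp: not_less le_less)
    then show ?thesis using sum_length_filter_compl[of "\<lambda>b. b < c" xs] by simp
  qed
  have "{c<..n} = (set xs \<inter> {c<..n}) \<union> {m \<in> missing n (c # xs). c < m}"
    by (auto simp: missing_def)
  then have "card {c<..n} = card (set xs \<inter> {c<..n}) + card {m \<in> missing n (c # xs). c < m}"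
    by (subst card_Un_disjoint[symmetric]) (auto simp: missing_def)
  then show ?thesis using 1 2 V by simp
qed

lemma inversions_swap:
  "a < b \<Longrightarrow> inversions (p @ b # a # q) = Suc (inversions (p @ a # b # q))"
  by (induction p) auto

lemma adjacent_decomposition:
  assumes "Suc i < length x"
  obtains p q where "x = p @ x ! i # x ! Suc i # q" "rook_act x (Suc i) = p @ x ! Suc i # x ! i # q"
proof
  let ?p = "take i x" and ?q = "drop (Suc (Suc i)) x"
  show x: "x = ?p @ x ! i # x ! Suc i # ?q"
    using assms by (metis Cons_nth_drop_Suc Suc_lessD append_take_drop_id)
  have "(?p @ a # b # ?q)[i := b, Suc i := a] = ?p @ b # a # ?q" for a b
    using assms by (simp add: list_update_append)
  then show "rook_act x (Suc i) = ?p @ x ! Suc i # x ! i # ?q"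
    using arg_cong[OF x, of "\<lambda>y. y[i := x ! Suc i, Suc i := x ! i]"] by simp
qed

lemma rook_length_swap:
  assumes "rook_vector n x" "Suc i < n" "x ! i < x ! Suc i"
  shows "rook_length n (rook_act x (Suc i)) = Suc (rook_length n x)"
proof -
  have "Suc i < length x" using assms by (simp add: rook_vector_def)
  then obtain p q where x: "x = p @ x ! i # x ! Suc i # q"
    and y: "rook_act x (Suc i) = p @ x ! Suc i # x ! i # q"
    by (rule adjacent_decomposition)
  have "inversions (rook_act x (Suc i)) = Suc (inversions x)"
    unfolding y inversions_swap[OF assms(3)] x[symmetric] ..
  then show ?thesis using \<open>Suc i < length x\<close> by (simp add: rook_length_def)
qed

text \<open>Erasing the first entry \<open>c\<close> adds \<open>c\<close> to the sum of missing
  letters and loses the inversions starting at \<open>c\<close>, which number \<open>c - 1\<close>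
  plus the count of missing letters above \<open>c\<close>.\<close>

lemma rook_length_kill:
  assumes "rook_vector n x" "0 < n" "x ! 0 \<noteq> 0"
  shows "rook_length n (rook_act x 0) + card {m \<in> missing n x. x ! 0 < m} = Suc (rook_length n x)"
proof -
  obtain c xs where x: "x = c # xs" "c \<noteq> 0"
    using assms by (cases x) (auto simp: rook_vector_def)
  have "missing n (0 # xs) = insert c (missing n (c # xs))"
    using assms x by (auto simp: missing_def rook_vector_def)
  moreover have "c \<notin> missing n (c # xs)" by (simp add: missing_def)
  ultimately have "\<Sum>(missing n (0 # xs)) = c + \<Sum>(missing n (c # xs))" by simp
  then show ?thesis
    using card_missing_above[of n c xs] assms x by (simp add: rook_length_def)
qed

lemma rook_act_swap_swap:
  assumes "Suc i < length x"
  shows "rook_act (rook_act x (Suc i)) (Suc i) = x"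
  using assms by (intro nth_equalityI) (auto simp: nth_list_update)

text \<open>At \<open>0\<close> a nonzero first entry gives growth one minus the number of missing
  letters above it; an exchange gives 1, 0 or -1 according to the order of the two entries.\<close>

lemma rook_length_rook_act_le:
  assumes "rook_vector n x" "a < n"
  shows "rook_length n (rook_act x a) \<le> Suc (rook_length n x)"
    and "rook_length n (rook_act x a) = Suc (rook_length n x) \<longleftrightarrow> ascent n x a"
proof -
  have "rook_length n (rook_act x a) \<le> Suc (rook_length n x) \<and>
    (rook_length n (rook_act x a) = Suc (rook_length n x) \<longleftrightarrow> ascent n x a)"
  proof (cases a)
    case 0
    show ?thesis
    proof (cases "x ! 0 = 0")
      case True
      then have "rook_act x 0 = x" by (metis list_update_id rook_act.simps(1))
      then show ?thesis using 0 True by simp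
    next
      case False
      have "x ! 0 \<notin> missing n x"
        using assms by (auto simp: missing_def rook_vector_def)
      then have "{m \<in> missing n x. x ! 0 < m} = {} \<longleftrightarrow> ascent n x 0"
        using False by (auto simp: not_less le_less)
      moreover have "card {m \<in> missing n x. x ! 0 < m} = 0 \<longleftrightarrow> {m \<in> missing n x. x ! 0 < m} = {}"
        by (intro card_0_eq) simp
      moreover have "rook_length n (rook_act x 0) + card {m \<in> missing n x. x ! 0 < m} =
          Suc (rook_length n x)"
        using rook_length_kill assms False 0 by blast
      ultimately show ?thesis unfolding 0 by linarith
    qed
  next
    case (Suc i)
    have l: "Suc i < length x" using assms Suc by (simp add: rook_vector_def)
    consider "x ! i < x ! Suc i" | "x ! i = x ! Suc i" | "x ! Suc i < x ! i" by linarith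
    then show ?thesis
    proof cases
      case 1
      then show ?thesis using rook_length_swap assms Suc by simp
    next
      case 2
      then have "rook_act x (Suc i) = x"
      proof -
        have "x[i := x ! Suc i] = x" by (subst 2[symmetric]) (rule list_update_id)
        then show ?thesis using 2 by simp
      qed
      then show ?thesis using 2 Suc by simp
    next
      case 3
      have "rook_length n x = Suc (rook_length n (rook_act x (Suc i)))"
        using rook_length_swap[of n "rook_act x (Suc i)" i] rook_act_swap_swap[OF l]
          rook_vector_rook_act[OF assms] 3 l assms Suc by simp
      then show ?thesis using 3 Suc by simp
    qed
  qed
  then show "rook_length n (rook_act x a) \<le> Suc (rook_length n x)"
    and "rook_length n (rook_act x a) = Suc (rook_length n x) \<longleftrightarrow> ascent n x a" by auto
qed

section \<open>Ascents and descents as mutually inverse moves\<close>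

lemma lower_raises:
  assumes "rook_vector n x" "a < n" "descent x a"
  shows "rook_vector n (lower n x a)" "ascent n (lower n x a) a" "rook_act (lower n x a) a = x"
proof -
  have "rook_vector n (lower n x a) \<and> ascent n (lower n x a) a \<and> rook_act (lower n x a) a = x"
  proof (cases a)
    case 0
    then obtain xs where x: "x = 0 # xs"
      using assms by (cases x) (auto simp: rook_vector_def)
    let ?m = "Max (missing n x)"
    have "missing n x \<noteq> {}" using missing_nonempty assms(1) x by simp
    then have m: "?m \<in> missing n x" "\<And>k. k \<in> missing n x \<Longrightarrow> k \<le> ?m" by simp_all
    have "rook_vector n (?m # xs)"
      using assms(1) missing_bound[OF m(1)] x by (auto simp: rook_vector_def)
    moreover have "k < ?m" if "k \<in> missing n (?m # xs)" for k
    proof -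
      have "k \<in> missing n x" "k \<noteq> ?m" using that x by (auto simp: missing_def)
      then show ?thesis using m(2)[of k] by linarith
    qed
    moreover have "?m \<noteq> 0" using missing_bound[OF m(1)] by simp
    ultimately show ?thesis using 0 x by simp
  next
    case (Suc i)
    then show ?thesis using assms rook_vector_rook_act[OF assms(1,2)] rook_act_swap_swap[of i x]
      by (auto simp: rook_vector_def)
  qed
  then show "rook_vector n (lower n x a)" "ascent n (lower n x a) a" "rook_act (lower n x a) a = x"
    by auto
qed

lemma ascent_lower:
  assumes "rook_vector n y" "a < n" "ascent n y a"
  shows "descent (rook_act y a) a" "lower n (rook_act y a) a = y"
proof -
  have "descent (rook_act y a) a \<and> lower n (rook_act y a) a = y"
  proof (cases a)
    case 0
    then obtain c xs where y: "y = c # xs" "c \<noteq> 0"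
      using assms by (cases y) (auto simp: rook_vector_def)
    have "missing n (0 # xs) = insert c (missing n (c # xs))"
      using assms y by (auto simp: missing_def rook_vector_def)
    then have "Max (missing n (0 # xs)) = c"
      using assms(3) y 0 by (intro Max_eqI) (auto simp: less_imp_le)
    then show ?thesis using y 0 by simp
  next
    case (Suc i)
    then show ?thesis using assms rook_act_swap_swap[of i y] by (auto simp: rook_vector_def)
  qed
  then show "descent (rook_act y a) a" "lower n (rook_act y a) a = y" by auto
qed

lemma rook_act_comm:
  assumes "Suc i < j" "Suc j < length x"
  shows "rook_act (rook_act x (Suc i)) (Suc j) = rook_act (rook_act x (Suc j)) (Suc i)"
proof -
  have "x[i := b, Suc i := a, j := d, Suc j := c] = x[j := d, Suc j := c, i := b, Suc i := a]"
    for a b c d using assms by (intro nth_equalityI) (simp_all add: nth_list_update)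
  then show ?thesis using assms by simp
qed

lemma list_update_0_rook_act:
  assumes "0 < j" "Suc j < length x"
  shows "(rook_act x (Suc j))[0 := m] = rook_act (x[0 := m]) (Suc j)"
proof -
  have "x \<noteq> []" using assms by auto
  then have "x[j := d, Suc j := c, 0 := m] = x[0 := m, j := d, Suc j := c]"
    for c d using assms by (intro nth_equalityI) (simp_all add: nth_list_update)
  then show ?thesis using assms by simp
qed

text \<open>The two letters touch disjoint positions; when \<open>a\<close> is \<open>0\<close>, the
  later exchange also preserves the set of missing letters, so the same maximum is restored in both
  orders.\<close>

lemma descents_far:
  assumes "rook_vector n x" "a < n" "b < n" "a + 2 \<le> b" "descent x a" "descent x b"
  shows "descent (lower n x a) b" "descent (lower n x b) a"
    "lower n (lower n x a) b = lower n (lower n x b) a"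
proof -
  obtain j where b: "b = Suc j" "a < j" using assms(4) by (cases b) auto
  have l: "length x = n" using assms(1) by (simp add: rook_vector_def)
  show "descent (lower n x a) b" using assms b l
    by (cases a) (auto simp: nth_list_update)
  show "descent (lower n x b) a" using assms b l
    by (cases a) (auto simp: nth_list_update)
  show "lower n (lower n x a) b = lower n (lower n x b) a"
  proof (cases a)
    case 0
    have "missing n (rook_act x (Suc j)) = missing n x"
      using assms(3) b l by simp
    then show ?thesis using 0 b l list_update_0_rook_act[of j x] assms(3)
      by (simp del: rook_act.simps)
  next
    case (Suc i)
    then show ?thesis using b assms(3,4) l rook_act_comm[of i j x]
      by (simp del: rook_act.simps)
  qed
qed

lemma rook_act_braid:
  assumes "Suc (Suc i) < length x"
  shows "rook_act (rook_act (rook_act x (Suc i)) (Suc (Suc i))) (Suc i) =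
    rook_act (rook_act (rook_act x (Suc (Suc i))) (Suc i)) (Suc (Suc i))"
proof -
  define a b c where abc: "a = x ! i" "b = x ! Suc i" "c = x ! Suc (Suc i)"
  have "rook_act x (Suc i) = x[i := b, Suc i := a]"
    "rook_act x (Suc (Suc i)) = x[Suc i := c, Suc (Suc i) := b]"
    by (simp_all add: abc)
  moreover have "rook_act (x[i := b, Suc i := a]) (Suc (Suc i)) = x[i := b, Suc i := c, Suc (Suc i) := a]"
    "rook_act (x[Suc i := c, Suc (Suc i) := b]) (Suc i) = x[i := c, Suc i := a, Suc (Suc i) := b]"
    using assms by (simp_all add: abc list_update_swap[of "Suc i" i] list_update_swap[of "Suc (Suc i)" i] list_update_swap[of "Suc (Suc i)" "Suc i"])
  moreover have "rook_act (x[i := b, Suc i := c, Suc (Suc i) := a]) (Suc i) = x[i := c, Suc i := b, Suc (Suc i) := a]"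
    using assms by (intro nth_equalityI) (simp_all add: nth_list_update)
  moreover have "rook_act (x[i := c, Suc i := a, Suc (Suc i) := b]) (Suc (Suc i)) = x[i := c, Suc i := b, Suc (Suc i) := a]"
    using assms by (intro nth_equalityI) (simp_all add: nth_list_update)
  ultimately show ?thesis by simp
qed

text \<open>Three strictly decreasing neighbours are brought into increasing order by either side of
  the braid relation, each exchange undoing one descent.\<close>

lemma descents_near:
  fixes n :: nat and x :: "nat list" and i :: nat
  assumes "Suc (Suc i) < length x" "descent x (Suc i)" "descent x (Suc (Suc i))"
  defines "y \<equiv> lower n x (Suc i)" and "z \<equiv> lower n x (Suc (Suc i))"
  shows "descent y (Suc (Suc i))" "descent (lower n y (Suc (Suc i))) (Suc i)"
    "descent z (Suc i)" "descent (lower n z (Suc i)) (Suc (Suc i))"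
    "lower n (lower n y (Suc (Suc i))) (Suc i) = lower n (lower n z (Suc i)) (Suc (Suc i))"
proof -
  show "descent y (Suc (Suc i))" "descent (lower n y (Suc (Suc i))) (Suc i)"
    "descent z (Suc i)" "descent (lower n z (Suc i)) (Suc (Suc i))"
    using assms by (simp_all add: nth_list_update)
  show "lower n (lower n y (Suc (Suc i))) (Suc i) = lower n (lower n z (Suc i)) (Suc (Suc i))"
    using rook_act_braid[OF assms(1)] by (simp add: y_def z_def del: rook_act.simps)
qed

text \<open>Without descents \<open>x\<close> is weakly increasing and does not start with 0, hence
  has no zeros; its \<open>n\<close> entries are then distinct and fill
  \<open>{1..n}\<close>.\<close>

lemma no_descent_imp_id:
  assumes "rook_vector n x" "\<And>a. a < n \<Longrightarrow> \<not> descent x a"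
  shows "x = [1..<Suc n]"
proof -
  have l: "length x = n" using assms(1) by (simp add: rook_vector_def)
  have s: "sorted x"
    using assms(2)[of "Suc _"] l by (auto simp: sorted_iff_nth_Suc not_less)
  have nz: "0 \<notin> set x"
  proof
    assume "0 \<in> set x"
    then obtain j where j: "j < n" "x ! j = 0" using l by (auto simp: in_set_conv_nth)
    then have "x ! 0 \<le> x ! j" using s l by (intro sorted_nth_mono) auto
    then show False using j assms(2)[of 0] by simp
  qed
  then have "filter (\<lambda>k. k \<noteq> 0) x = x"
    by (intro filter_True ballI notI) simp
  then have d: "distinct x"
    using assms(1) by (simp add: rook_vector_def)
  have "set x = {1..n}"
  proof (rule card_subset_eq)
    show "set x \<subseteq> {1..n}"
    proof
      fix k assume "k \<in> set x"
      then have "k \<noteq> 0" using nz by metis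
      moreover have "k \<le> n" using \<open>k \<in> set x\<close> assms(1) by (auto simp: rook_vector_def)
      ultimately show "k \<in> {1..n}" by simp
    qed
    show "card (set x) = card {1..n}" using d l by (simp add: distinct_card)
  qed simp
  then have "set x = set [1..<Suc n]"
    by (simp only: set_upt atLeastLessThanSuc_atLeastAtMost)
  then show ?thesis by (rule sorted_distinct_set_unique[OF s d sorted_upt distinct_upt])
qed

section \<open>Ascending words\<close>

lemma transformable_refl: "transformable R u u"
  by (simp add: transformable_def)

lemma transformable_sym: "transformable R u v \<Longrightarrow> transformable R v u"
  unfolding transformable_def by (rule equivclp_sym)

lemma transformable_trans: "transformable R u v \<Longrightarrow> transformable R v w \<Longrightarrow> transformable R u w"
  unfolding transformable_def by (rule equivclp_trans)

lemma transformable_rel: "(u, v) \<in> R \<Longrightarrow> transformable R u v"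
  unfolding transformable_def rewrite_step_def
  by (rule r_into_equivclp) (metis append.left_neutral append.right_neutral)

lemma transformable_prefix: "transformable R u v \<Longrightarrow> transformable R (p @ u) (p @ v)"
  using transformable_append transformable_refl by metis

lemma transformable_suffix: "transformable R u v \<Longrightarrow> transformable R (u @ q) (v @ q)"
  using transformable_append transformable_refl by metis

section \<open>Ascending words and Matsumoto's argument\<close>

inductive ascending :: "nat \<Rightarrow> nat list \<Rightarrow> nat list \<Rightarrow> bool" for n where
  Nil: "ascending n [] [1..<Suc n]"
| snoc: "ascending n w x \<Longrightarrow> a < n \<Longrightarrow> ascent n x a \<Longrightarrow> ascending n (w @ [a]) (rook_act x a)"

lemma rook_vector_id: "rook_vector n [1..<Suc n]"
  by (auto simp: rook_vector_def simp del: upt_Suc)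

lemma ascending_rook_vector: "ascending n w x \<Longrightarrow> rook_vector n x"
  by (induction rule: ascending.induct) (simp_all only: rook_vector_id rook_vector_rook_act)

lemma inversions_sorted: "sorted x \<Longrightarrow> inversions x = 0"
  by (induction x) (auto simp: filter_empty_conv not_less)

lemma rook_length_id: "rook_length n [1..<Suc n] = 0"
proof -
  have "missing n [1..<Suc n] = {}" by (auto simp: missing_def simp del: upt_Suc)
  then show ?thesis by (simp add: rook_length_def inversions_sorted del: upt_Suc)
qed

lemma ascending_length: "ascending n w x \<Longrightarrow> length w = rook_length n x"
proof (induction rule: ascending.induct)
  case Nil
  show ?case by (simp only: rook_length_id list.size)
next
  case (snoc w x a)
  then have "rook_length n (rook_act x a) = Suc (rook_length n x)"
    using rook_length_rook_act_le(2) ascending_rook_vector by blast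
  then show ?case using snoc by simp
qed

lemma ascending_lists: "ascending n w x \<Longrightarrow> w \<in> lists {..<n}"
  by (induction rule: ascending.induct) auto

lemma ascending_lower:
  assumes "ascending n w (lower n x a)" "rook_vector n x" "a < n" "descent x a"
  shows "ascending n (w @ [a]) x"
  using ascending.snoc[OF assms(1,3)] lower_raises[OF assms(2-4)] by simp

text \<open>As long as there is a descent, \<open>lower\<close> undoes it and decreases
  \<open>rook_length\<close>; the process stops at the identity vector by
  \<open>no_descent_imp_id\<close>.\<close>

lemma ascending_exists:
  assumes "rook_vector n x"
  shows "\<exists>w. ascending n w x"
  using assms
proof (induction "rook_length n x" arbitrary: x rule: less_induct)
  case less
  show ?case
  proof (cases "\<exists>a<n. descent x a")
    case True
    then obtain a where a: "a < n" "descent x a" by blast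
    note l = lower_raises[OF less.prems a]
    have "rook_length n (lower n x a) < rook_length n x"
      using rook_length_rook_act_le(2)[OF l(1) a(1)] l by simp
    then show ?thesis using less.hyps l(1) ascending_lower less.prems a by blast
  next
    case False
    then show ?thesis using no_descent_imp_id less.prems ascending.Nil by blast
  qed
qed

lemma ascending_snocD:
  assumes "ascending n (w @ [a]) x"
  shows "a < n" "descent x a" "ascending n w (lower n x a)"
proof -
  obtain y where y: "ascending n w y" "a < n" "ascent n y a" "x = rook_act y a"
    using assms by (cases rule: ascending.cases) auto
  then show "a < n" "descent x a" "ascending n w (lower n x a)"
    using ascent_lower[OF ascending_rook_vector[OF y(1)] y(2,3)] by auto
qed

text \<open>Induction on the length of \<open>x\<close>. The last letters \<open>a\<close> and
  \<open>b\<close> of the two words are both descents of \<open>x\<close>; a common ascending word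
  \<open>w\<close> is found below both, the induction hypothesis rewrites each word so that it
  begins with \<open>w\<close>, and a single relation joins the endings.\<close>

lemma ascending_transformable:
  assumes comm: "\<And>i j. \<lbrakk>i < n; j < n; i + 2 \<le> j\<rbrakk> \<Longrightarrow> transformable R [i, j] [j, i]"
    and braid: "\<And>i. \<lbrakk>1 \<le> i; i + 1 < n\<rbrakk> \<Longrightarrow> transformable R [i, i + 1, i] [i + 1, i, i + 1]"
    and "ascending n u x" "ascending n v x"
  shows "transformable R u v"
  using assms(3,4)
proof (induction "rook_length n x" arbitrary: u v x rule: less_induct)
  case less
  note V = ascending_rook_vector[OF less.prems(1)]
  then have lx: "length x = n" by (simp add: rook_vector_def)
  have step: "transformable R w w'"
    if "a < n" "descent x a" "ascending n w (lower n x a)" "ascending n w' (lower n x a)" for w w' a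
  proof -
    note l = lower_raises[OF V that(1,2)]
    have "rook_length n (lower n x a) < rook_length n x"
      using rook_length_rook_act_le(2)[OF l(1) that(1)] l by simp
    then show ?thesis using less.hyps that by blast
  qed
  have main: "transformable R (u' @ [a]) (v' @ [b])"
    if ab: "a \<le> b" and u: "ascending n (u' @ [a]) x" and v: "ascending n (v' @ [b]) x" for u' v' a b
  proof -
    note du = ascending_snocD[OF u] and dv = ascending_snocD[OF v]
    note lu = lower_raises[OF V du(1,2)] and lv = lower_raises[OF V dv(1,2)]
    consider "a = b" | "b = Suc a" | "a + 2 \<le> b" using ab by linarith
    then show ?thesis
    proof cases
      case 1
      then have "transformable R u' v'" using step du dv by blast
      then show ?thesis using 1 transformable_append transformable_refl by metis
    next
      case 2
      \<comment> \<open>A descent at \<open>0\<close> means that the first entry is 0, and nothing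
        lies below 0, so there is no descent at \<open>1\<close>; hence \<open>a\<close> is a
        successor.\<close>
      then obtain i where i: "a = Suc i" "b = Suc (Suc i)"
        using du(2) dv(2) by (cases a) auto
      have Va: "rook_vector n (lower n x a)" and Vb: "rook_vector n (lower n x b)" by fact+
      note d = descents_near[OF dv(1)[folded lx, unfolded i] du(2)[unfolded i] dv(2)[unfolded i], folded i]
      have Vab: "rook_vector n (lower n (lower n x a) b)" and Vba: "rook_vector n (lower n (lower n x b) a)"
        using lower_raises(1) Va Vb d du(1) dv(1) by blast+
      \<comment> \<open>\<open>w\<close> leads to the vector three steps below \<open>x\<close>,
        where the two sides of the braid relation meet by \<open>d(5)\<close>.\<close>
      obtain w where w: "ascending n w (lower n (lower n (lower n x a) b) a)"
        using ascending_exists lower_raises(1)[OF Vab du(1) d(2)] by blast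
      have "ascending n ((w @ [a]) @ [b]) (lower n x a)"
        using ascending_lower w Va Vab d du(1) dv(1) by blast
      then have 1: "transformable R u' (w @ [a, b])" using step du by simp
      have "ascending n ((w @ [b]) @ [a]) (lower n x b)"
        using ascending_lower[OF ascending_lower] w[unfolded d(5)] Vb Vba d du(1) dv(1) by blast
      then have 2: "transformable R v' (w @ [b, a])" using step dv by simp
      have "transformable R [a, b, a] [b, a, b]" using braid[of a] i dv(1) by simp
      then have "transformable R (w @ [a, b, a]) (w @ [b, a, b])"
        using transformable_append transformable_refl by blast
      moreover have "transformable R (u' @ [a]) (w @ [a, b, a])"
        using transformable_append[OF 1 transformable_refl[of R "[a]"]] by simp
      moreover have "transformable R (v' @ [b]) (w @ [b, a, b])"
        using transformable_append[OF 2 transformable_refl[of R "[b]"]] by simp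
      ultimately show ?thesis by (meson transformable_sym transformable_trans)
    next
      case 3
      note d = descents_far[OF V du(1) dv(1) 3 du(2) dv(2)]
      obtain w where w: "ascending n w (lower n (lower n x a) b)"
        using ascending_exists lower_raises(1)[OF lu(1) dv(1) d(1)] by blast
      have "ascending n (w @ [b]) (lower n x a)"
        using ascending_lower w lu(1) d dv(1) by blast
      then have 1: "transformable R u' (w @ [b])" using step du by simp
      have "ascending n (w @ [a]) (lower n x b)"
        using ascending_lower w[unfolded d(3)] lv(1) d du(1) by blast
      then have 2: "transformable R v' (w @ [a])" using step dv by simp
      have "transformable R [a, b] [b, a]" using comm 3 du(1) dv(1) by blast
      then have "transformable R (w @ [a, b]) (w @ [b, a])"
        using transformable_append transformable_refl by blast
      moreover have "transformable R (u' @ [a]) (w @ [b, a])"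
        using transformable_append[OF 1 transformable_refl[of R "[a]"]] by simp
      moreover have "transformable R (v' @ [b]) (w @ [a, b])"
        using transformable_append[OF 2 transformable_refl[of R "[b]"]] by simp
      ultimately show ?thesis by (meson transformable_sym transformable_trans)
    qed
  qed
  have len: "length u = length v" using ascending_length less.prems by metis
  show ?case
  proof (cases u rule: rev_cases)
    case Nil
    then show ?thesis using len transformable_refl by simp
  next
    case (snoc u' a)
    then obtain v' b where v: "v = v' @ [b]" using len by (cases v rule: rev_cases) auto
    show ?thesis
    proof (cases "a \<le> b")
      case True
      then show ?thesis using main less.prems snoc v by blast
    next
      case False
      then have "b \<le> a" by simp
      then show ?thesis using main less.prems snoc v transformable_sym by blast
    qed
  qed
qed

section \<open>Actions that follow \<open>rook_act\<close> at ascents\<close>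

fun hecke_act :: "nat list \<Rightarrow> nat \<Rightarrow> nat list" where
  "hecke_act x 0 = rook_act x 0"
| "hecke_act x (Suc i) = (if x ! i < x ! Suc i then rook_act x (Suc i) else x)"

lemma length_hecke_act [simp]: "length (hecke_act x a) = length x"
  by (cases a) simp_all

lemma hecke_act_ascent: "ascent n x a \<Longrightarrow> hecke_act x a = rook_act x a"
  by (cases a) simp_all

text \<open>Common abstraction of \<open>rook_act\<close> and \<open>hecke_act\<close>: away from
  ascents the action may stay put or follow \<open>rook_act\<close>. The length arguments rely on
  this alone.\<close>

definition ascent_action :: "nat \<Rightarrow> (nat list \<Rightarrow> nat \<Rightarrow> nat list) \<Rightarrow> bool" where
  "ascent_action n f \<longleftrightarrow> (\<forall>x a. rook_vector n x \<longrightarrow> a < n \<longrightarrow>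
    f x a \<in> {x, rook_act x a} \<and> (ascent n x a \<longrightarrow> f x a = rook_act x a))"

lemma ascent_action_rook_act: "ascent_action n rook_act"
  by (simp add: ascent_action_def)

lemma ascent_action_hecke_act: "ascent_action n hecke_act"
proof -
  have "hecke_act x a \<in> {x, rook_act x a}" for x a
    by (cases a) simp_all
  then show ?thesis using hecke_act_ascent unfolding ascent_action_def by blast
qed

lemma ascending_foldl:
  assumes "ascent_action n f" "ascending n w x"
  shows "foldl f [1..<Suc n] w = x"
  using assms(2)
proof (induction rule: ascending.induct)
  case Nil
  show ?case by (simp only: foldl.simps)
next
  case (snoc w x a)
  then have "f x a = rook_act x a"
    using assms(1) ascending_rook_vector unfolding ascent_action_def by blast
  then show ?case using snoc.IH by (simp only: foldl_append foldl.simps)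
qed

text \<open>The length starts at 0 and grows by at most one per letter, so it can reach
  \<open>length w\<close> only if every letter is an ascent.\<close>

lemma foldl_ascending:
  assumes f: "ascent_action n f" and w: "w \<in> lists {..<n}"
  defines "x \<equiv> foldl f [1..<Suc n] w"
  shows "rook_vector n x \<and> rook_length n x \<le> length w \<and>
    (rook_length n x = length w \<longrightarrow> ascending n w x)"
  using w unfolding x_def
proof (induction w rule: rev_induct)
  case Nil
  show ?case
    unfolding foldl.simps using rook_vector_id rook_length_id[of n] ascending.Nil by (metis le0)
next
  case (snoc a w)
  define y where "y = foldl f [1..<Suc n] w"
  have a: "a < n" using snoc.prems by simp
  have y: "rook_vector n y" "rook_length n y \<le> length w"
    "rook_length n y = length w \<Longrightarrow> ascending n w y"
    using snoc unfolding y_def by auto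
  have "f y a = y \<or> f y a = rook_act y a"
    using f y(1) a unfolding ascent_action_def by blast
  then have "rook_vector n (f y a) \<and> rook_length n (f y a) \<le> Suc (length w) \<and>
      (rook_length n (f y a) = Suc (length w) \<longrightarrow> ascending n (w @ [a]) (f y a))"
  proof
    assume "f y a = y"
    then show ?thesis using y by auto
  next
    assume "f y a = rook_act y a"
    then show ?thesis
      using y a rook_vector_rook_act[OF y(1) a] rook_length_rook_act_le[OF y(1) a]
        ascending.snoc[of n w y a] by auto
  qed
  then show ?case unfolding foldl_append foldl.simps y_def[symmetric] by simp
qed

section \<open>The rook monoid\<close>

text \<open>Row \<open>r\<close> is stored as \<open>Suc r\<close>; the entry 0 matches no row and
  so encodes a zero column.\<close>

definition rook_matrix :: "nat \<Rightarrow> nat list \<Rightarrow> int mat" where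
  "rook_matrix n x = mat n n (\<lambda>(r, c). if x ! c = Suc r then 1 else 0)"

lemma rook_matrix_gen:
  assumes "length x = n" "a < n"
  shows "rook_matrix n x * rook_gen n a = rook_matrix n (rook_act x a)"
proof (cases a)
  case 0
  have "rook_matrix n x * mat_diag n (\<lambda>k. if k = 0 then 0 else 1) = rook_matrix n (rook_act x 0)"
    using assms by (subst mat_diag_mult_right[of _ n])
      (auto simp: rook_matrix_def nth_list_update intro!: eq_matI)
  then show ?thesis using 0 by (simp add: rook_gen_def rook_pi0_def)
next
  case (Suc i)
  have l: "Suc i < length x" using assms Suc by simp
  let ?t = "Transposition.transpose i (Suc i)"
  have "rook_matrix n x * rook_s n (Suc i) = rook_matrix n (rook_act x (Suc i))"
  proof (rule eq_matI)
    fix r c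
    assume "r < dim_row (rook_matrix n (rook_act x (Suc i)))"
      "c < dim_col (rook_matrix n (rook_act x (Suc i)))"
    then have rc: "r < n" "c < n" by (simp_all add: rook_matrix_def)
    have t: "?t c < n" using rc l assms by (simp add: Transposition.transpose_def)
    \<comment> \<open>Column \<open>c\<close> of \<open>rook_s n (Suc i)\<close> has its only 1 in
      row \<open>?t c\<close>, so the sum collapses to one term.\<close>
    have "(rook_matrix n x * rook_s n (Suc i)) $$ (r, c) =
        (\<Sum>k = 0..<n. (if x ! k = Suc r then 1 else 0) * (if k = ?t c then 1 else 0))"
      using rc by (simp add: rook_matrix_def rook_s_def scalar_prod_def)
    also have "\<dots> = (\<Sum>k = 0..<n. if k = ?t c then (if x ! k = Suc r then 1 else 0) else 0)"
      by (intro sum.cong) auto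
    also have "\<dots> = (if x ! ?t c = Suc r then 1 else 0)"
      using t by (simp only: sum.delta finite_atLeastLessThan) simp
    also have "x ! ?t c = rook_act x (Suc i) ! c"
      using l rc assms by (simp add: Transposition.transpose_def nth_list_update)
    also have "(if rook_act x (Suc i) ! c = Suc r then 1 else 0) = rook_matrix n (rook_act x (Suc i)) $$ (r, c)"
      using rc by (simp add: rook_matrix_def)
    finally show "(rook_matrix n x * rook_s n (Suc i)) $$ (r, c) =
      rook_matrix n (rook_act x (Suc i)) $$ (r, c)" .
  qed (simp_all add: rook_matrix_def rook_s_def)
  then show ?thesis using Suc by (simp add: rook_gen_def)
qed

lemma rook_vector_nth_le:
  assumes "rook_vector n x" "i < n"
  shows "x ! i \<le> n"
proof -
  have "x ! i \<in> set x" using assms by (intro nth_mem) (simp add: rook_vector_def)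
  then have "x ! i \<in> {..n}" using assms(1) unfolding rook_vector_def by blast
  then show ?thesis by simp
qed

lemma rook_matrix_inject:
  assumes "rook_vector n x" "rook_vector n y" "rook_matrix n x = rook_matrix n y"
  shows "x = y"
proof (rule nth_equalityI)
  show "length x = length y" using assms by (simp add: rook_vector_def)
  fix c assume "c < length x"
  then have c: "c < n" using assms by (simp add: rook_vector_def)
  have e: "x ! c = Suc r \<longleftrightarrow> y ! c = Suc r" if "r < n" for r
    using arg_cong[OF assms(3), of "\<lambda>M. M $$ (r, c)"] that c
    by (simp add: rook_matrix_def split: if_splits)
  \<comment> \<open>The bound makes every nonzero entry a \<open>Suc r\<close> with
    \<open>r < n\<close>, which the matrix detects by \<open>e\<close>; hence zeros correspond as
    well.\<close>
  have "x ! c \<le> n" "y ! c \<le> n"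
    using assms(1,2) c rook_vector_nth_le by blast+
  then show "x ! c = y ! c"
    using e[of "x ! c - 1"] e[of "y ! c - 1"] by (cases "x ! c"; cases "y ! c") simp_all
qed

text \<open>\<open>word_value\<close> multiplies from the right end, whereas vectors are acted on
  from the left end of the word; associativity links the two.\<close>

lemma word_value_snoc:
  assumes "monoid G" "\<And>a. a \<in> A \<Longrightarrow> g a \<in> carrier G" "w \<in> lists A" "a \<in> A"
  shows "word_value G g (w @ [a]) = word_value G g w \<otimes>\<^bsub>G\<^esub> g a"
proof -
  interpret monoid G by fact
  have closed: "word_value G g v \<in> carrier G" if "v \<in> lists A" for v
    using that by induction (simp_all add: word_value_def assms(2))
  show ?thesis using assms(3)
  proof induction
    case Nil
    then show ?case using assms(2,4) by (simp add: word_value_def)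
  next
    case (Cons b v)
    then show ?case
      using closed[of v] assms(2,4) m_assoc[of "g b" "word_value G g v" "g a"]
      by (simp add: word_value_def)
  qed
qed

lemma word_value_rook:
  assumes "w \<in> lists {..<n}"
  shows "word_value (rook_monoid n) (rook_gen n) w = rook_matrix n (foldl rook_act [1..<Suc n] w)"
  using assms
proof (induction w rule: rev_induct)
  case Nil
  have "1\<^sub>m n = rook_matrix n [1..<Suc n]"
    unfolding rook_matrix_def by (intro eq_matI) (auto simp del: upt_Suc)
  then show ?case unfolding word_value_def foldr.simps foldl.simps id_apply
    by (simp only: rook_monoid_def monoid.simps)
next
  case (snoc a w)
  then have a: "a < n" "w \<in> lists {..<n}" by auto
  have "length (foldl rook_act [1..<Suc n] w) = n"
    using foldl_ascending[OF ascent_action_rook_act a(2)] by (simp only: rook_vector_def)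
  note m = rook_matrix_gen[OF this a(1)]
  have "word_value (rook_monoid n) (rook_gen n) (w @ [a]) =
      word_value (rook_monoid n) (rook_gen n) w * rook_gen n a"
    using word_value_snoc[OF monoid_rook_monoid, of "{..<n}" "rook_gen n" n w a] rook_gen_carrier a
    by (simp add: rook_monoid_def)
  then show ?case using m snoc.IH a(2) by (simp only: foldl_append foldl.simps)
qed

text \<open>The ascending word \<open>v\<close> has the length of the common vector, and the reduced
  word \<open>u\<close> is no longer than \<open>v\<close>; by \<open>foldl_ascending\<close> it is
  no shorter either, and equality makes \<open>u\<close> ascending.\<close>

lemma reduced_word_ascending:
  assumes f: "ascent_action n f" and red: "reduced_word G {..<n} g u"
    and v: "ascending n v (foldl f [1..<Suc n] u)" "word_value G g v = word_value G g u"
  shows "ascending n u (foldl f [1..<Suc n] u)"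
proof -
  have u: "u \<in> lists {..<n}" using red by (simp add: reduced_word_def)
  have "length u \<le> length v"
    using red v ascending_lists unfolding reduced_word_def by blast
  then show ?thesis using foldl_ascending[OF f u] ascending_length[OF v(1)] by auto
qed

lemma reduced_rook_word_ascending:
  assumes "reduced_word (rook_monoid n) {..<n} (rook_gen n) u"
  shows "ascending n u (foldl rook_act [1..<Suc n] u)"
proof -
  have u: "u \<in> lists {..<n}" using assms by (simp add: reduced_word_def)
  obtain v where v: "ascending n v (foldl rook_act [1..<Suc n] u)"
    using ascending_exists foldl_ascending[OF ascent_action_rook_act u] by blast
  have "word_value (rook_monoid n) (rook_gen n) v = word_value (rook_monoid n) (rook_gen n) u"
    unfolding word_value_rook[OF u] word_value_rook[OF ascending_lists[OF v]]
      ascending_foldl[OF ascent_action_rook_act v] ..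
  then show ?thesis using reduced_word_ascending[OF ascent_action_rook_act assms v] by blast
qed

section \<open>The monoid \<open>R\<^sub>n\<^sup>0\<close>\<close>

lemma hecke_act_idem:
  assumes "a < length x"
  shows "hecke_act (hecke_act x a) a = hecke_act x a"
  using assms by (cases a) (simp_all add: nth_list_update)

text \<open>Both sides sort the three entries into weakly decreasing order.\<close>

lemma hecke_act_braid:
  assumes "Suc (Suc i) < length x"
  shows "hecke_act (hecke_act (hecke_act x (Suc i)) (Suc (Suc i))) (Suc i) =
    hecke_act (hecke_act (hecke_act x (Suc (Suc i))) (Suc i)) (Suc (Suc i))"
proof -
  let ?u = "\<lambda>a b c. x[i := a, Suc i := b, Suc (Suc i) := c]"
  have 1: "hecke_act (?u a b c) (Suc i) = (if a < b then ?u b a c else ?u a b c)" for a b c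
  proof -
    have "?u a b c ! i = a" "?u a b c ! Suc i = b"
      using assms by (simp_all add: nth_list_update)
    moreover have "(?u a b c)[i := b, Suc i := a] = ?u b a c"
      using assms by (intro nth_equalityI) (simp_all add: nth_list_update)
    ultimately show ?thesis by simp
  qed
  have 2: "hecke_act (?u a b c) (Suc (Suc i)) = (if b < c then ?u a c b else ?u a b c)" for a b c
  proof -
    have "?u a b c ! Suc i = b" "?u a b c ! Suc (Suc i) = c"
      using assms by (simp_all add: nth_list_update)
    moreover have "(?u a b c)[Suc i := c, Suc (Suc i) := b] = ?u a c b"
      using assms by (intro nth_equalityI) (simp_all add: nth_list_update)
    ultimately show ?thesis by simp
  qed
  have x: "x = ?u (x ! i) (x ! Suc i) (x ! Suc (Suc i))" by simp
  have "hecke_act (hecke_act (hecke_act (?u a b c) (Suc i)) (Suc (Suc i))) (Suc i) =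
    hecke_act (hecke_act (hecke_act (?u a b c) (Suc (Suc i))) (Suc i)) (Suc (Suc i))" for a b c
    by (simp del: hecke_act.simps add: 1 2)
  from this[of "x ! i" "x ! Suc i" "x ! Suc (Suc i)"] show ?thesis unfolding x[symmetric] .
qed

lemma hecke_act_comm:
  assumes "a + 2 \<le> b" "b < length x"
  shows "hecke_act (hecke_act x a) b = hecke_act (hecke_act x b) a"
proof -
  obtain j where b: "b = Suc j" "a < j" using assms(1) by (cases b) auto
  have j: "hecke_act x b ! k = x ! k" if "k < j" for k using b that by simp
  show ?thesis
  proof (cases a)
    case 0
    then show ?thesis using b assms list_update_0_rook_act[of j x 0]
      by (simp del: rook_act.simps(2))
  next
    case (Suc i)
    have "hecke_act x a ! k = x ! k" if "j \<le> k" for k using b Suc that by simp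
    then show ?thesis using b assms Suc j rook_act_comm[of i j x]
      by (simp del: rook_act.simps)
  qed
qed

lemma hecke_act_0_1:
  assumes "1 < length x"
  shows "hecke_act (hecke_act (hecke_act x 0) 1) 0 = x[0 := 0, 1 := 0]"
    "hecke_act (hecke_act (hecke_act (hecke_act x 1) 0) 1) 0 = x[0 := 0, 1 := 0]"
    "hecke_act (x[0 := 0, 1 := 0]) 1 = x[0 := 0, 1 := 0]"
proof -
  obtain a b q where "x = a # b # q" using assms by (cases x; cases "tl x") auto
  then show "hecke_act (hecke_act (hecke_act x 0) 1) 0 = x[0 := 0, 1 := 0]"
    "hecke_act (hecke_act (hecke_act (hecke_act x 1) 0) 1) 0 = x[0 := 0, 1 := 0]"
    "hecke_act (x[0 := 0, 1 := 0]) 1 = x[0 := 0, 1 := 0]"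
    by (simp_all)
qed

lemma R0_rels_hecke_act:
  assumes "(l, r) \<in> R0_rels n" "length x = n"
  shows "foldl hecke_act x l = foldl hecke_act x r"
proof -
  consider (idem) i where "i < n" "l = [i, i]" "r = [i]"
    | (braid) i where "1 \<le> i" "i + 1 < n" "l = [i, i + 1, i]" "r = [i + 1, i, i + 1]"
    | (one) "1 < n" "l = [1, 0, 1, 0]" "r = [0, 1, 0]"
    | (two) "1 < n" "l = [0, 1, 0]" "r = [0, 1, 0, 1]"
    | (comm) i j where "i < n" "j < n" "\<bar>int i - int j\<bar> \<ge> 2" "l = [i, j]" "r = [j, i]"
    using assms(1) unfolding R0_rels_def R0_braid_rels_def R0_commutation_rels_def
    by (auto split: if_splits)
  then show ?thesis
  proof cases
    case idem
    then show ?thesis using hecke_act_idem assms(2) by (simp del: hecke_act.simps)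
  next
    case braid
    then obtain k where "i = Suc k" by (cases i) auto
    then show ?thesis using hecke_act_braid[of k x] braid assms(2) by (simp del: hecke_act.simps)
  next
    case one
    then show ?thesis using hecke_act_0_1[of x] assms(2)
      by (simp del: hecke_act.simps One_nat_def)
  next
    case two
    then show ?thesis using hecke_act_0_1[of x] assms(2)
      by (simp del: hecke_act.simps One_nat_def)
  next
    case comm
    then have "i + 2 \<le> j \<or> j + 2 \<le> i" by linarith
    then show ?thesis using hecke_act_comm[of i j x] hecke_act_comm[of j i x] comm assms(2)
      by (auto simp del: hecke_act.simps)
  qed
qed

lemma length_foldl_hecke_act [simp]: "length (foldl hecke_act x w) = length x"
  by (induction w arbitrary: x) simp_all

lemma transformable_hecke_act:
  assumes "transformable (R0_rels n) u v" "length x = n"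
  shows "foldl hecke_act x u = foldl hecke_act x v"
  using assms(1) unfolding transformable_def
proof (induction rule: equivclp_induct)
  case base
  show ?case ..
next
  case (step v w)
  have "foldl hecke_act x p = foldl hecke_act x q" if pq: "rewrite_step (R0_rels n) p q" for p q
  proof -
    obtain s t l r where "(l, r) \<in> R0_rels n" "p = s @ l @ t" "q = s @ r @ t"
      using pq unfolding rewrite_step_def by blast
    then show ?thesis using R0_rels_hecke_act[of l r n "foldl hecke_act x s"] assms(2) by simp
  qed
  then show ?case using step by metis
qed

section \<open>Every word is equivalent to an ascending one\<close>

abbreviation R0_equiv :: "nat \<Rightarrow> nat list \<Rightarrow> nat list \<Rightarrow> bool" where
  "R0_equiv n \<equiv> transformable (R0_rels n)"

lemma R0_equiv_idem: "a < n \<Longrightarrow> R0_equiv n [a, a] [a]"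
  by (rule transformable_rel) (auto simp: R0_rels_def)

lemma R0_equiv_braid: "Suc (Suc i) < n \<Longrightarrow>
    R0_equiv n [Suc i, Suc (Suc i), Suc i] [Suc (Suc i), Suc i, Suc (Suc i)]"
  by (rule transformable_rel) (auto simp: R0_rels_def R0_braid_rels_def)

lemma R0_equiv_comm: "a + 2 \<le> b \<Longrightarrow> b < n \<Longrightarrow> R0_equiv n [a, b] [b, a]"
  by (rule transformable_rel) (auto simp: R0_rels_def R0_commutation_rels_def)

lemma R0_equiv_0_1:
  assumes "Suc 0 < n"
  shows "R0_equiv n [Suc 0, 0, Suc 0, 0] [0, Suc 0, 0]" "R0_equiv n [0, Suc 0, 0, Suc 0] [0, Suc 0, 0]"
  using assms transformable_rel[of _ _ "R0_rels n"] transformable_sym[OF transformable_rel, of _ _ "R0_rels n"]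
  by (simp_all add: R0_rels_def)

lemma R0_equiv_ascending:
  assumes "ascending n u x" "ascending n v x"
  shows "R0_equiv n u v"
proof (rule ascending_transformable[OF _ _ assms])
  fix i j :: nat assume "i < n" "j < n" "i + 2 \<le> j"
  then show "R0_equiv n [i, j] [j, i]" by (intro R0_equiv_comm)
next
  fix i :: nat assume "1 \<le> i" "i + 1 < n"
  then show "R0_equiv n [i, i + 1, i] [i + 1, i, i + 1]"
    using R0_equiv_braid[of "i - 1" n] by (cases i) simp_all
qed

text \<open>Extending an ascending word for \<open>lower n x a\<close> by \<open>a\<close> gives one
  for \<open>x\<close>, and all ascending words for \<open>x\<close> are equivalent by the Matsumoto
  argument.\<close>

lemma ascending_peel:
  assumes "ascending n w x" "a < n" "descent x a"
  obtains w' where "ascending n w' (lower n x a)" "R0_equiv n w (w' @ [a])" "length w = Suc (length w')"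
proof -
  have V: "rook_vector n x" using assms(1) by (rule ascending_rook_vector)
  obtain w' where w': "ascending n w' (lower n x a)"
    using ascending_exists lower_raises(1)[OF V assms(2,3)] by blast
  have a: "ascending n (w' @ [a]) x" using ascending_lower[OF w' V assms(2,3)] .
  have "length w = Suc (length w')"
    using ascending_length[OF a] ascending_length[OF assms(1)] by simp
  then show thesis using that w' R0_equiv_ascending[OF assms(1) a] by blast
qed

text \<open>Rewrite \<open>w\<close> so that it ends in \<open>a\<close>; idempotence then absorbs
  the extra \<open>a\<close>.\<close>

lemma R0_equiv_descent:
  assumes "ascending n w x" "a < n" "descent x a"
  shows "R0_equiv n (w @ [a]) w"
proof -
  obtain w' where w': "R0_equiv n w (w' @ [a])" using ascending_peel[OF assms] by blast
  have "R0_equiv n (w @ [a]) (w' @ [a, a])" using transformable_suffix[OF w', of "[a]"] by simp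
  moreover have "R0_equiv n (w' @ [a, a]) (w' @ [a])"
    by (rule transformable_prefix[OF R0_equiv_idem[OF assms(2)]])
  ultimately show ?thesis using w' by (meson transformable_sym transformable_trans)
qed

text \<open>Walk left from the zero: a nonzero left neighbour gives a descent, a zero one continues
  the walk, and a zero in position 0 is itself a descent.\<close>

lemma zero_imp_descent: "x ! k = 0 \<Longrightarrow> \<exists>j\<le>k. descent x j"
proof (induction k)
  case 0
  then show ?case by auto
next
  case (Suc k)
  show ?case
  proof (cases "x ! k = 0")
    case True
    then show ?thesis using Suc.IH le_SucI by blast
  next
    case False
    then have "descent x (Suc k)" using Suc.prems by simp
    then show ?thesis by blast
  qed
qed

text \<open>The same walk, stopped at position 1; the descents it can meet commute with
  \<open>0\<close>.\<close>

lemma zero_imp_descent_ge_2: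
  "x ! Suc q = 0 \<Longrightarrow> x ! 1 = 0 \<or> (\<exists>k<q. descent x (Suc (Suc k)))"
proof (induction q)
  case 0
  then show ?case by simp
next
  case (Suc q)
  show ?case
  proof (cases "x ! Suc q = 0")
    case True
    then show ?thesis using Suc.IH less_SucI by blast
  next
    case False
    then have "descent x (Suc (Suc q))" using Suc.prems by simp
    then show ?thesis by blast
  qed
qed

lemma nth_lower_far:
  "a < k \<Longrightarrow> lower n x a ! k = x ! k"
  by (cases a) simp_all

lemma nth_lower_Suc:
  assumes "Suc i < length x"
  shows "lower n x (Suc i) ! i = x ! Suc i" "lower n x (Suc i) ! Suc i = x ! i"
    "k < i \<Longrightarrow> lower n x (Suc i) ! k = x ! k"
  using assms by (simp_all add: nth_list_update)

lemma nth_lower_0_pos: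
  assumes "rook_vector n x" "0 < n" "x ! 0 = 0"
  shows "0 < lower n x 0 ! 0"
  using lower_raises(2)[of n x 0] assms by simp

text \<open>Two adjacent zeros are fixed by the generator exchanging them. At the front this is the
  relation \<open>\<pi>\<^sub>0\<pi>\<^sub>1\<pi>\<^sub>0\<pi>\<^sub>1 = \<pi>\<^sub>0\<pi>\<^sub>1\<pi>\<^sub>0\<close>; elsewhere the zeros are first moved to the left.\<close>

lemma R0_equiv_adjacent_zeros:
  assumes "ascending n w x" "Suc i < n" "x ! i = 0" "x ! Suc i = 0"
  shows "R0_equiv n (w @ [Suc i]) w"
  using assms
proof (induction "length w" arbitrary: w x i rule: less_induct)
  case less
  have V: "rook_vector n x" using less.prems(1) by (rule ascending_rook_vector)
  then have l: "length x = n" by (simp add: rook_vector_def)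
  show ?case
  proof (cases i)
    case 0
    have n: "0 < n" "Suc 0 < n" using less.prems 0 by simp_all
    have d: "descent x 0" using less.prems 0 by simp
    obtain w1 where w1: "ascending n w1 (lower n x 0)" "R0_equiv n w (w1 @ [0])"
      using ascending_peel[OF less.prems(1) n(1) d] by blast
    \<comment> \<open>Restoring a first letter puts a nonzero entry before the second zero, and
      undoing that descent brings the zero to the front; hence \<open>w\<close> can be made to end
      in \<open>0\<close>, \<open>1\<close>, \<open>0\<close>.\<close>
    define y where "y = lower n x 0"
    have y: "0 < y ! 0" "y ! Suc 0 = 0" "length y = n"
      using nth_lower_0_pos[OF V n(1)] nth_lower_far[of 0 "Suc 0" n x] less.prems 0 l
      unfolding y_def by simp_all
    then have d1: "descent y (Suc 0)" by simp
    obtain w2 where w2: "ascending n w2 (lower n y (Suc 0))" "R0_equiv n w1 (w2 @ [Suc 0])"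
      using ascending_peel[OF w1(1)[folded y_def] n(2) d1] by blast
    have d2: "descent (lower n y (Suc 0)) 0" using nth_lower_Suc[of 0 y n] y n by simp
    obtain w3 where w3: "R0_equiv n w2 (w3 @ [0])"
      using ascending_peel[OF w2(1) n(1) d2] by blast
    have "R0_equiv n w (w3 @ [0, Suc 0, 0])"
      using transformable_suffix[OF w3, of "[Suc 0, 0]"] transformable_suffix[OF w2(2), of "[0]"] w1(2)
      by simp (meson transformable_trans)
    moreover from transformable_suffix[OF this, of "[Suc 0]"]
    have "R0_equiv n (w @ [Suc 0]) (w3 @ [0, Suc 0, 0, Suc 0])" by simp
    moreover have "R0_equiv n (w3 @ [0, Suc 0, 0, Suc 0]) (w3 @ [0, Suc 0, 0])"
      by (rule transformable_prefix[OF R0_equiv_0_1(2)[OF n(2)]])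
    ultimately show ?thesis unfolding 0 by (meson transformable_sym transformable_trans)
  next
    case (Suc k)
    show ?thesis
    proof (cases "x ! k = 0")
      case True
      \<comment> \<open>A third zero on the left yields a descent \<open>j \<le> k\<close>; this
        letter commutes with \<open>Suc i\<close>, and peeling it off leaves the two zeros in
        place.\<close>
      then obtain j where j: "j \<le> k" "descent x j" using zero_imp_descent by blast
      have jn: "j < n" using j less.prems Suc by simp
      obtain w1 where w1: "ascending n w1 (lower n x j)" "R0_equiv n w (w1 @ [j])" "length w = Suc (length w1)"
        using ascending_peel[OF less.prems(1) jn j(2)] by blast
      have "lower n x j ! i = 0" "lower n x j ! Suc i = 0"
        using j less.prems Suc by (simp_all add: nth_lower_far)
      then have IH: "R0_equiv n (w1 @ [Suc i]) w1"
        using less.hyps w1 less.prems(2) by simp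
      have "R0_equiv n (w @ [Suc i]) (w1 @ [j, Suc i])"
        using transformable_suffix[OF w1(2), of "[Suc i]"] by simp
      moreover have "R0_equiv n (w1 @ [j, Suc i]) (w1 @ [Suc i, j])"
        using j Suc less.prems(2) by (intro transformable_prefix R0_equiv_comm) simp_all
      moreover have "R0_equiv n (w1 @ [Suc i, j]) (w1 @ [j])"
        using transformable_suffix[OF IH, of "[j]"] by simp
      ultimately show ?thesis using w1(2) by (meson transformable_sym transformable_trans)
    next
      case False
      \<comment> \<open>Peeling off \<open>Suc k\<close> and \<open>Suc (Suc k)\<close> moves the
        nonzero entry \<open>x ! k\<close> past both zeros. They end up one place further left,
        where the induction hypothesis absorbs \<open>Suc k\<close>, and the braid relation
        transports this back to \<open>Suc (Suc k)\<close>.\<close>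
      have n: "Suc k < n" "Suc (Suc k) < n" using less.prems Suc by simp_all
      have d: "descent x (Suc k)" using False less.prems Suc by simp
      obtain w1 where w1: "ascending n w1 (lower n x (Suc k))" "R0_equiv n w (w1 @ [Suc k])"
        "length w = Suc (length w1)"
        using ascending_peel[OF less.prems(1) n(1) d] by blast
      define y where "y = lower n x (Suc k)"
      have y: "y ! k = 0" "y ! Suc k = x ! k" "y ! Suc (Suc k) = 0" "length y = n"
        using nth_lower_Suc[of k x n] nth_lower_far[of "Suc k" "Suc (Suc k)" n x] less.prems Suc l
        unfolding y_def by simp_all
      have d1: "descent y (Suc (Suc k))" using y False by simp
      obtain w2 where w2: "ascending n w2 (lower n y (Suc (Suc k)))" "R0_equiv n w1 (w2 @ [Suc (Suc k)])"
        "length w1 = Suc (length w2)"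
        using ascending_peel[OF w1(1)[folded y_def] n(2) d1] by blast
      have "lower n y (Suc (Suc k)) ! k = 0" "lower n y (Suc (Suc k)) ! Suc k = 0"
        using nth_lower_Suc[of "Suc k" y n] y n by simp_all
      then have IH: "R0_equiv n (w2 @ [Suc k]) w2"
        using less.hyps w2 w1(3) n by simp
      have w: "R0_equiv n w (w2 @ [Suc (Suc k), Suc k])"
        using transformable_trans[OF w1(2)] transformable_suffix[OF w2(2), of "[Suc k]"] by simp
      have "R0_equiv n (w @ [Suc (Suc k)]) (w2 @ [Suc (Suc k), Suc k, Suc (Suc k)])"
        using transformable_suffix[OF w, of "[Suc (Suc k)]"] by simp
      moreover have "R0_equiv n (w2 @ [Suc k, Suc (Suc k), Suc k]) (w2 @ [Suc (Suc k), Suc k, Suc (Suc k)])"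
        using n by (intro transformable_prefix R0_equiv_braid) simp_all
      moreover have "R0_equiv n (w2 @ [Suc k, Suc (Suc k), Suc k]) (w2 @ [Suc (Suc k), Suc k])"
        using transformable_suffix[OF IH, of "[Suc (Suc k), Suc k]"] by simp
      ultimately show ?thesis using w unfolding Suc by (meson transformable_sym transformable_trans)
    qed
  qed
qed

lemma rook_vector_nth_eq:
  assumes "rook_vector n x" "Suc i < n" "x ! i = x ! Suc i"
  shows "x ! i = 0"
proof -
  have "Suc i < length x" using assms by (simp add: rook_vector_def)
  then obtain p q where x: "x = p @ x ! i # x ! Suc i # q"
    by (rule adjacent_decomposition)
  have "distinct (filter (\<lambda>k. k \<noteq> 0) (p @ x ! i # x ! Suc i # q))"
    using assms(1) unfolding rook_vector_def x[symmetric] by blast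
  then show ?thesis using assms(3) by (simp split: if_splits)
qed

text \<open>An ascent extends the word, a descent is absorbed, and equal neighbours must be two
  zeros because nonzero entries are distinct.\<close>

lemma R0_normal_Suc:
  assumes "ascending n w x" "Suc i < n"
  shows "\<exists>v y. R0_equiv n (w @ [Suc i]) v \<and> ascending n v y"
proof -
  consider "x ! i < x ! Suc i" | "x ! i = x ! Suc i" | "x ! Suc i < x ! i" by linarith
  then show ?thesis
  proof cases
    case 1
    then have "ascent n x (Suc i)" by simp
    then show ?thesis using ascending.snoc assms transformable_refl by blast
  next
    case 2
    then have "x ! i = 0" "x ! Suc i = 0"
      using rook_vector_nth_eq ascending_rook_vector assms by metis+
    then show ?thesis using R0_equiv_adjacent_zeros assms by blast
  next
    case 3
    then have "descent x (Suc i)" by simp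
    then show ?thesis using R0_equiv_descent assms by blast
  qed
qed

lemma foldl_hecke_act_R0_equiv:
  assumes "R0_equiv n u v"
  shows "foldl hecke_act [1..<Suc n] u = foldl hecke_act [1..<Suc n] v"
  using transformable_hecke_act[OF assms, of "[1..<Suc n]"] by simp

text \<open>The vector is invariant under the relations, so \<open>u\<close> also reaches
  \<open>y\<close>; its length, attained by \<open>v\<close>, bounds \<open>length u\<close> from
  below.\<close>

lemma R0_equiv_length_le:
  assumes "R0_equiv n u v" "ascending n v y" "u \<in> lists {..<n}"
  shows "length v \<le> length u"
proof -
  have "y = foldl hecke_act [1..<Suc n] u"
    using foldl_hecke_act_R0_equiv[OF assms(1)]
      ascending_foldl[OF ascent_action_hecke_act assms(2)] by simp
  then show ?thesis
    using foldl_ascending[OF ascent_action_hecke_act assms(3)] ascending_length[OF assms(2)] by simp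
qed

text \<open>Without zeros the \<open>n\<close> entries are distinct elements of
  \<open>{1..n}\<close>, which leaves no room for a missing letter.\<close>

lemma missing_imp_zero:
  assumes "rook_vector n x" "m \<in> missing n x"
  shows "0 \<in> set x"
proof (rule ccontr)
  assume nz: "0 \<notin> set x"
  then have "filter (\<lambda>k. k \<noteq> 0) x = x" by (intro filter_True ballI notI) simp
  then have "card (set x) = n" using assms(1) by (simp add: rook_vector_def distinct_card)
  moreover have "set x \<subseteq> {1..n} - {m}"
  proof
    fix k assume k: "k \<in> set x"
    then have "k \<noteq> 0" using nz by metis
    moreover have "k \<le> n" using k assms(1) by (auto simp: rook_vector_def)
    moreover have "k \<noteq> m" using k missing_bound[OF assms(2)] by blast
    ultimately show "k \<in> {1..n} - {m}" by simp
  qed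
  then have "card (set x) \<le> card ({1..n} - {m})" by (intro card_mono) simp_all
  ultimately show False using missing_bound[OF assms(2)] by auto
qed

text \<open>If \<open>x\<close> does not ascend at \<open>0\<close>, then some missing letter exceeds its first one. Unless a letter
  commuting with \<open>\<pi>\<^sub>0\<close> can be split off, a word for \<open>x\<close> can be chosen to end in \<open>\<pi>\<^sub>1\<pi>\<^sub>0\<pi>\<^sub>1\<close>, and
  \<open>\<pi>\<^sub>1\<pi>\<^sub>0\<pi>\<^sub>1\<pi>\<^sub>0 = \<pi>\<^sub>0\<pi>\<^sub>1\<pi>\<^sub>0\<close> shortens it.\<close>

lemma R0_normal_0:
  assumes "ascending n w x" "0 < n"
  shows "\<exists>v y. R0_equiv n (w @ [0]) v \<and> ascending n v y"
  using assms(1)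
proof (induction "length w" arbitrary: w x rule: less_induct)
  case less
  have V: "rook_vector n x" using less.prems by (rule ascending_rook_vector)
  then have l: "length x = n" by (simp add: rook_vector_def)
  have n0: "0 < n" by fact
  consider "ascent n x 0" | "descent x 0" | "x ! 0 \<noteq> 0" "\<not> ascent n x 0" by auto
  then show ?case
  proof cases
    case 1
    then show ?thesis using ascending.snoc less.prems n0 transformable_refl by blast
  next
    case 2
    then show ?thesis using R0_equiv_descent less.prems n0 by blast
  next
    case 3
    then obtain m where m: "m \<in> missing n x" "\<not> m < x ! 0" by auto
    have "x ! 0 \<in> set x" using l n0 by simp
    then have xm: "x ! 0 < m" using missing_bound[OF m(1)] m(2) by (metis nat_neq_iff)
    obtain q where q: "q < n" "x ! q = 0"
      using missing_imp_zero[OF V m(1)] l by (auto simp: in_set_conv_nth)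
    then obtain p where p: "Suc p < n" "x ! Suc p = 0" using 3 by (cases q) auto
    show ?thesis
    proof (cases "\<exists>k. Suc (Suc k) < n \<and> descent x (Suc (Suc k))")
      case True
      then obtain k where k: "Suc (Suc k) < n" "descent x (Suc (Suc k))" by blast
      let ?j = "Suc (Suc k)"
      obtain w1 where w1: "ascending n w1 (lower n x ?j)" "R0_equiv n w (w1 @ [?j])"
        "length w = Suc (length w1)"
        using ascending_peel[OF less.prems k] by blast
      obtain v1 y1 where v1: "R0_equiv n (w1 @ [0]) v1" "ascending n v1 y1"
        using less.hyps[OF _ w1(1)] w1(3) by auto
      obtain v y where v: "R0_equiv n (v1 @ [?j]) v" "ascending n v y"
        using R0_normal_Suc[OF v1(2) k(1)] by blast
      have "R0_equiv n (w @ [0]) (w1 @ [?j, 0])"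
        using transformable_suffix[OF w1(2), of "[0]"] by simp
      moreover have "R0_equiv n (w1 @ [0, ?j]) (w1 @ [?j, 0])"
        using k(1) by (intro transformable_prefix R0_equiv_comm) simp_all
      moreover have "R0_equiv n (w1 @ [0, ?j]) (v1 @ [?j])"
        using transformable_suffix[OF v1(1), of "[?j]"] by simp
      ultimately have "R0_equiv n (w @ [0]) v"
        using v(1) by (meson transformable_sym transformable_trans)
      then show ?thesis using v(2) by blast
    next
      case False
      have x1: "x ! 1 = 0" using zero_imp_descent_ge_2[OF p(2)] False p(1) by auto
      have n1: "Suc 0 < n" using p by simp
      have d1: "descent x (Suc 0)" using x1 3 by simp
      obtain w1 where w1: "ascending n w1 (lower n x (Suc 0))" "R0_equiv n w (w1 @ [Suc 0])"
        "length w = Suc (length w1)"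
        using ascending_peel[OF less.prems n1 d1] by blast
      define y where "y = lower n x (Suc 0)"
      have y: "y ! 0 = 0" "y ! Suc 0 = x ! 0" "length y = n"
        using nth_lower_Suc[of 0 x n] l n1 x1 unfolding y_def by simp_all
      have my: "m \<in> missing n y"
        using m(1) missing_rook_act_Suc[of 0 x n] n1 l unfolding y_def by simp
      have d2: "descent y 0" using y by simp
      obtain w2 where w2: "ascending n w2 (lower n y 0)" "R0_equiv n w1 (w2 @ [0])"
        "length w1 = Suc (length w2)"
        using ascending_peel[OF w1(1)[folded y_def] n0 d2] by blast
      \<comment> \<open>The letter restored at the front is at least \<open>m\<close> and so exceeds
        \<open>x ! 0\<close>, now in second place; this third descent completes the ending
        \<open>1\<close>, \<open>0\<close>, \<open>1\<close>.\<close>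
      have "x ! 0 < Max (missing n y)" using xm Max_ge[OF finite_missing my] by linarith
      then have d3: "descent (lower n y 0) (Suc 0)" using y n0 by simp
      obtain s where s: "ascending n s (lower n (lower n y 0) (Suc 0))" "R0_equiv n w2 (s @ [Suc 0])"
        "length w2 = Suc (length s)"
        using ascending_peel[OF w2(1) n1 d3] by blast
      have "R0_equiv n w (s @ [Suc 0, 0, Suc 0])"
        using transformable_suffix[OF s(2), of "[0, Suc 0]"]
          transformable_suffix[OF w2(2), of "[Suc 0]"] w1(2)
        by simp (meson transformable_trans)
      from transformable_suffix[OF this, of "[0]"]
      have 1: "R0_equiv n (w @ [0]) (s @ [Suc 0, 0, Suc 0, 0])" by simp
      have 2: "R0_equiv n (s @ [Suc 0, 0, Suc 0, 0]) (s @ [0, Suc 0, 0])"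
        by (rule transformable_prefix[OF R0_equiv_0_1(1)[OF n1]])
      obtain v1 y1 where v1: "R0_equiv n (s @ [0]) v1" "ascending n v1 y1"
        using less.hyps[OF _ s(1)] s(3) w2(3) w1(3) by auto
      obtain v2 y2 where v2: "R0_equiv n (v1 @ [Suc 0]) v2" "ascending n v2 y2"
        using R0_normal_Suc[OF v1(2) n1] by blast
      \<comment> \<open>\<open>s\<close> is three letters shorter than \<open>w\<close> and each of
        the two appended letters costs at most one, so \<open>v2\<close> is still shorter than
        \<open>w\<close> and induction handles the last \<open>0\<close>.\<close>
      have "s @ [0] \<in> lists {..<n}" "v1 @ [Suc 0] \<in> lists {..<n}"
        using ascending_lists[OF s(1)] ascending_lists[OF v1(2)] n0 n1 by simp_all
      then have "length v2 < length w"
        using R0_equiv_length_le[OF v1] R0_equiv_length_le[OF v2] s(3) w2(3) w1(3) by simp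
      then obtain v z where v: "R0_equiv n (v2 @ [0]) v" "ascending n v z"
        using less.hyps v2(2) by blast
      have "R0_equiv n (s @ [0, Suc 0, 0]) (v1 @ [Suc 0, 0])"
        using transformable_suffix[OF v1(1), of "[Suc 0, 0]"] by simp
      moreover have "R0_equiv n (v1 @ [Suc 0, 0]) (v2 @ [0])"
        using transformable_suffix[OF v2(1), of "[0]"] by simp
      ultimately have "R0_equiv n (w @ [0]) v"
        using 1 2 v(1) by (meson transformable_trans)
      then show ?thesis using v(2) by blast
    qed
  qed
qed

lemma R0_normal:
  assumes "u \<in> lists {..<n}"
  shows "\<exists>v y. R0_equiv n u v \<and> ascending n v y"
  using assms
proof (induction u rule: rev_induct)
  case Nil
  then show ?case using ascending.Nil transformable_refl by blast
next
  case (snoc a u)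
  then obtain v y where v: "R0_equiv n u v" "ascending n v y" by auto
  have "a < n" using snoc.prems by simp
  then obtain v' y' where v': "R0_equiv n (v @ [a]) v'" "ascending n v' y'"
    using R0_normal_0 R0_normal_Suc v(2) by (cases a) blast+
  then show ?case using transformable_suffix[OF v(1), of "[a]"] transformable_trans by blast
qed

lemma word_value_R0_eq_iff:
  "word_value (R0_monoid n) (R0_gen n) u = word_value (R0_monoid n) (R0_gen n) v \<longleftrightarrow> R0_equiv n u v"
  unfolding word_value_R0 eq_equiv_class_iff[OF equiv_word_congruence UNIV_I UNIV_I]
  by (simp add: word_congruence_def)

lemma reduced_R0_word_ascending:
  assumes "reduced_word (R0_monoid n) {..<n} (R0_gen n) u"
  shows "ascending n u (foldl hecke_act [1..<Suc n] u)"
proof -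
  have u: "u \<in> lists {..<n}" using assms by (simp add: reduced_word_def)
  \<comment> \<open>Equality in a presented monoid has to come from the relations, so the ascending
    word is obtained by rewriting \<open>u\<close>; invariance shows that its vector is that of
    \<open>u\<close>.\<close>
  obtain v y where v: "R0_equiv n u v" "ascending n v y" using R0_normal[OF u] by blast
  have y: "y = foldl hecke_act [1..<Suc n] u"
    using foldl_hecke_act_R0_equiv[OF v(1)] ascending_foldl[OF ascent_action_hecke_act v(2)] by simp
  show ?thesis
    using reduced_word_ascending[OF ascent_action_hecke_act assms v(2)[unfolded y]]
      word_value_R0_eq_iff transformable_sym[OF v(1)] by blast
qed

theorem theorem3p54:
  fixes n :: nat
  shows
    "(\<forall>u v.
        reduced_word (R0_monoid n) {..<n} (R0_gen n) u \<longrightarrow>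
        reduced_word (R0_monoid n) {..<n} (R0_gen n) v \<longrightarrow>
        word_value (R0_monoid n) (R0_gen n) u = word_value (R0_monoid n) (R0_gen n) v \<longrightarrow>
        transformable (R0_braid_rels n \<union> R0_commutation_rels n) u v) \<and>
     (\<forall>u v.
        reduced_word (rook_monoid n) {..<n} (rook_gen n) u \<longrightarrow>
        reduced_word (rook_monoid n) {..<n} (rook_gen n) v \<longrightarrow>
        word_value (rook_monoid n) (rook_gen n) u = word_value (rook_monoid n) (rook_gen n) v \<longrightarrow>
        transformable (rook_braid_rels n \<union> rook_commutation_rels n) u v)"
proof (intro conjI allI impI)
  fix u v
  assume uv: "reduced_word (R0_monoid n) {..<n} (R0_gen n) u"
    "reduced_word (R0_monoid n) {..<n} (R0_gen n) v"
    "word_value (R0_monoid n) (R0_gen n) u = word_value (R0_monoid n) (R0_gen n) v"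
  have eq: "foldl hecke_act [1..<Suc n] u = foldl hecke_act [1..<Suc n] v"
    using foldl_hecke_act_R0_equiv uv(3) word_value_R0_eq_iff by blast
  show "transformable (R0_braid_rels n \<union> R0_commutation_rels n) u v"
  proof (rule ascending_transformable)
    show "ascending n u (foldl hecke_act [1..<Suc n] v)"
      "ascending n v (foldl hecke_act [1..<Suc n] v)"
      using reduced_R0_word_ascending[OF uv(1)] reduced_R0_word_ascending[OF uv(2)] by (simp_all only: eq)
  qed (rule transformable_rel; auto simp: R0_braid_rels_def R0_commutation_rels_def)+
next
  fix u v
  assume uv: "reduced_word (rook_monoid n) {..<n} (rook_gen n) u"
    "reduced_word (rook_monoid n) {..<n} (rook_gen n) v"
    "word_value (rook_monoid n) (rook_gen n) u = word_value (rook_monoid n) (rook_gen n) v"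
  have l: "u \<in> lists {..<n}" "v \<in> lists {..<n}" using uv by (simp_all add: reduced_word_def)
  \<comment> \<open>Rook vectors are determined by their matrices, so equal values give equal
    vectors.\<close>
  have eq: "foldl rook_act [1..<Suc n] u = foldl rook_act [1..<Suc n] v"
    using uv(3) foldl_ascending[OF ascent_action_rook_act l(1)]
      foldl_ascending[OF ascent_action_rook_act l(2)] rook_matrix_inject
    unfolding word_value_rook[OF l(1)] word_value_rook[OF l(2)] by blast
  show "transformable (rook_braid_rels n \<union> rook_commutation_rels n) u v"
  proof (rule ascending_transformable)
    show "ascending n u (foldl rook_act [1..<Suc n] v)"
      "ascending n v (foldl rook_act [1..<Suc n] v)"
      using reduced_rook_word_ascending[OF uv(1)] reduced_rook_word_ascending[OF uv(2)] by (simp_all only: eq)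
  qed (rule transformable_rel; auto simp: rook_braid_rels_def rook_commutation_rels_def)+
qed

end
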